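(* For every $\varepsilon>0$, there is a $(1+\varepsilon)$-approximate Turing kernelization for \textsc{Independent Dominating Set} parameterized by $\mathrm{tw}+\Delta$ whose oracle queries are graphs with $\mathcal{O}(\frac{1+\varepsilon}{\varepsilon}\cdot\mathrm{tw}\cdot\Delta^2)$ vertices.
   Context: \textsc{Independent Dominating Set}: given a graph $G=(V,E)$, find a minimum-size set $X\subseteq V$ that is independent and satisfies $N[X]=V$. $\mathrm{tw}$ is the treewidth and $\Delta$ the maximum degree of the input graph. The algorithm receives the graph together with a nice tree decomposition of width $\mathrm{tw}(G)$ (rooted, root and leaf bags empty, every other node a forget, introduce, or join node). A $(1+\varepsilon)$-approximate Turing kernelization is a polynomial-time algorithm that, with access to an oracle returning in a single step a $c$-approximate solution for any instance of bounded size (here: with the stated number of vertices), outputs a $c(1+\varepsilon)$-approximate solution for the input, without knowing or depending on $c$. *)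

theory Defs
  imports Complex_Main "HOL-Computational_Algebra.Polynomial"
begin

section \<open>Graphs\<close>

datatype 'a graph = Graph (verts: "'a set") (edges: "'a set set")

definition simple_graph :: "'a graph \<Rightarrow> bool" where
  "simple_graph G \<longleftrightarrow> finite (verts G) \<and> (\<forall>e\<in>edges G. e \<subseteq> verts G \<and> card e = 2)"

definition vertex_degree :: "'a graph \<Rightarrow> 'a \<Rightarrow> nat" where
  "vertex_degree G v = card {u. {u, v} \<in> edges G}"

text \<open>The maximum degree of the graph without vertices is 0.\<close>

definition max_degree :: "'a graph \<Rightarrow> nat" where
  "max_degree G = Max (insert 0 (vertex_degree G ` verts G))"

definition walk :: "'a graph \<Rightarrow> 'a list \<Rightarrow> bool" where
  "walk G xs \<longleftrightarrow> xs \<noteq> [] \<and> set xs \<subseteq> verts G \<and> successively (\<lambda>u v. {u, v} \<in> edges G) xs"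

definition connected_in :: "'a graph \<Rightarrow> 'a set \<Rightarrow> bool" where
  "connected_in G S \<longleftrightarrow>
     (\<forall>u\<in>S. \<forall>v\<in>S. \<exists>xs. walk G xs \<and> set xs \<subseteq> S \<and> hd xs = u \<and> last xs = v)"

definition cycle :: "'a graph \<Rightarrow> 'a list \<Rightarrow> bool" where
  "cycle G xs \<longleftrightarrow> walk G xs \<and> distinct xs \<and> length xs \<ge> 3 \<and> {last xs, hd xs} \<in> edges G"

definition is_tree :: "'a graph \<Rightarrow> bool" where
  "is_tree T \<longleftrightarrow>
     simple_graph T \<and> verts T \<noteq> {} \<and> connected_in T (verts T) \<and> (\<nexists>xs. cycle T xs)"


section \<open>Independent dominating sets\<close>

definition independent :: "'a graph \<Rightarrow> 'a set \<Rightarrow> bool" where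
  "independent G X \<longleftrightarrow> (\<forall>u\<in>X. \<forall>v\<in>X. {u, v} \<notin> edges G)"

definition closed_nbhd :: "'a graph \<Rightarrow> 'a set \<Rightarrow> 'a set" where
  "closed_nbhd G X = X \<union> {v. \<exists>u\<in>X. {u, v} \<in> edges G}"

definition ind_dom_set :: "'a graph \<Rightarrow> 'a set \<Rightarrow> bool" where
  "ind_dom_set G X \<longleftrightarrow> X \<subseteq> verts G \<and> independent G X \<and> closed_nbhd G X = verts G"

definition ids_opt :: "'a graph \<Rightarrow> nat" where
  "ids_opt G = Min (card ` {X. ind_dom_set G X})"

definition approx_ids :: "real \<Rightarrow> 'a graph \<Rightarrow> 'a set \<Rightarrow> bool" where
  "approx_ids c G X \<longleftrightarrow> ind_dom_set G X \<and> real (card X) \<le> c * real (ids_opt G)"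


section \<open>Treewidth\<close>

definition tree_decomposition :: "'a graph \<Rightarrow> 'n graph \<Rightarrow> ('n \<Rightarrow> 'a set) \<Rightarrow> bool" where
  "tree_decomposition G T X \<longleftrightarrow>
     is_tree T \<and>
     (\<Union>t\<in>verts T. X t) = verts G \<and>
     (\<forall>e\<in>edges G. \<exists>t\<in>verts T. e \<subseteq> X t) \<and>
     (\<forall>v\<in>verts G. connected_in T {t \<in> verts T. v \<in> X t})"

text \<open>
  Subtraction is truncated: if all bags are empty, which only happens for the graph without
  vertices, the width is 0 and not -1.
\<close>

definition width :: "'n graph \<Rightarrow> ('n \<Rightarrow> 'a set) \<Rightarrow> nat" where
  "width T X = Max ((\<lambda>t. card (X t)) ` verts T) - 1"

definition treewidth :: "'a graph \<Rightarrow> nat" where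
  "treewidth G = (LEAST w. \<exists>(T :: nat graph) X. tree_decomposition G T X \<and> width T X = w)"


section \<open>Nice tree decompositions\<close>

datatype 'b rtree = Rooted (root_label: 'b) (subtrees: "'b rtree list")

text \<open>
  A node of a rooted tree is the sequence of child indices that leads to it from the root.
\<close>

fun subtree_at :: "'b rtree \<Rightarrow> nat list \<Rightarrow> 'b rtree option" where
  "subtree_at t [] = Some t"
| "subtree_at (Rooted b ts) (i # p) = (if i < length ts then subtree_at (ts ! i) p else None)"

definition label_at :: "'b rtree \<Rightarrow> nat list \<Rightarrow> 'b" where
  "label_at t p = root_label (the (subtree_at t p))"

definition tree_graph :: "'b rtree \<Rightarrow> nat list graph" where
  "tree_graph t =
     Graph {p. subtree_at t p \<noteq> None} {{p, p @ [i]} | p i. subtree_at t (p @ [i]) \<noteq> None}"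

definition leaf_node :: "'a set \<Rightarrow> 'a set rtree list \<Rightarrow> bool" where
  "leaf_node B ts \<longleftrightarrow> ts = [] \<and> B = {}"

definition introduce_node :: "'a set \<Rightarrow> 'a set rtree list \<Rightarrow> bool" where
  "introduce_node B ts \<longleftrightarrow>
     (\<exists>s v. ts = [s] \<and> v \<notin> root_label s \<and> B = insert v (root_label s))"

definition forget_node :: "'a set \<Rightarrow> 'a set rtree list \<Rightarrow> bool" where
  "forget_node B ts \<longleftrightarrow>
     (\<exists>s v. ts = [s] \<and> v \<in> root_label s \<and> B = root_label s - {v})"

definition join_node :: "'a set \<Rightarrow> 'a set rtree list \<Rightarrow> bool" where
  "join_node B ts \<longleftrightarrow> (\<exists>s s'. ts = [s, s'] \<and> root_label s = B \<and> root_label s' = B)"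

fun nice_below :: "'a set rtree \<Rightarrow> bool" where
  "nice_below (Rooted B ts) \<longleftrightarrow>
     (leaf_node B ts \<or> introduce_node B ts \<or> forget_node B ts \<or> join_node B ts) \<and>
     (\<forall>t\<in>set ts. nice_below t)"

text \<open>
  Of the root only an empty bag is required. The usual variant, in which the root also has to be
  a leaf, introduce, forget or join node, is a special case.
\<close>

definition nice_tree_decomposition :: "'a graph \<Rightarrow> 'a set rtree \<Rightarrow> bool" where
  "nice_tree_decomposition G t \<longleftrightarrow>
     tree_decomposition G (tree_graph t) (label_at t) \<and>
     root_label t = {} \<and> (\<forall>s\<in>set (subtrees t). nice_below s)"


section \<open>Oracle programs\<close>

text \<open>
  The model of computation is a first-order, call-by-value functional language over binary trees
  (in the style of Jones's WHILE and F languages), extended by oracle queries. A program is a list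
  of function bodies; function 0 is the entry point. Variables are de Bruijn indices into the
  environment, and every function has exactly one argument.
\<close>

datatype data = Leaf | Node data data

datatype expr =
    Var nat
  | Mk_Leaf
  | Mk_Node expr expr
  | Case expr expr expr
  | Bind expr expr
  | Call nat expr
  | Query expr

text \<open>
  \<open>eval P orc env e v n qs\<close>: with oracle \<open>orc\<close>, the expression \<open>e\<close> evaluates to \<open>v\<close> in time \<open>n\<close>
  and \<open>qs\<close> is the list of the queries made. The length of the environments is bounded in terms
  of the program, so every rule is a constant number of pointer operations and costs 1. Since
  values may be shared, a tree can be exponentially larger than the time spent on constructing it;
  a query is therefore also charged for the size of the tree that is handed to the oracle, as if
  it were written on a query tape. The answer arrives in a single step.
\<close>

inductive eval ::
  "expr list \<Rightarrow> (data \<Rightarrow> data) \<Rightarrow> data list \<Rightarrow> expr \<Rightarrow> data \<Rightarrow> nat \<Rightarrow> data list \<Rightarrow> bool"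
  for P :: "expr list" and orc :: "data \<Rightarrow> data"
where
  eval_Var: "i < length env \<Longrightarrow> eval P orc env (Var i) (env ! i) 1 []"
| eval_Leaf: "eval P orc env Mk_Leaf Leaf 1 []"
| eval_Node:
    "eval P orc env a u m qs \<Longrightarrow> eval P orc env b v n rs \<Longrightarrow>
     eval P orc env (Mk_Node a b) (Node u v) (m + n + 1) (qs @ rs)"
| eval_Case_Leaf:
    "eval P orc env a Leaf m qs \<Longrightarrow> eval P orc env b v n rs \<Longrightarrow>
     eval P orc env (Case a b c) v (m + n + 1) (qs @ rs)"
| eval_Case_Node:
    "eval P orc env a (Node x y) m qs \<Longrightarrow> eval P orc (x # y # env) c v n rs \<Longrightarrow>
     eval P orc env (Case a b c) v (m + n + 1) (qs @ rs)"
| eval_Bind: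
    "eval P orc env a u m qs \<Longrightarrow> eval P orc (u # env) b v n rs \<Longrightarrow>
     eval P orc env (Bind a b) v (m + n + 1) (qs @ rs)"
| eval_Call:
    "f < length P \<Longrightarrow> eval P orc env a u m qs \<Longrightarrow> eval P orc [u] (P ! f) v n rs \<Longrightarrow>
     eval P orc env (Call f a) v (m + n + 1) (qs @ rs)"
| eval_Query:
    "eval P orc env a u m qs \<Longrightarrow>
     eval P orc env (Query a) (orc u) (m + size u + 1) (qs @ [u])"

definition runs ::
  "expr list \<Rightarrow> (data \<Rightarrow> data) \<Rightarrow> data \<Rightarrow> data \<Rightarrow> nat \<Rightarrow> data list \<Rightarrow> bool" where
  "runs P orc x y n qs \<longleftrightarrow> eval P orc [x] (Call 0 (Var 0)) y n qs"

lemma eval_deterministic: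
  assumes "eval P orc env e v n qs" and "eval P orc env e v' n' qs'"
  shows "v' = v \<and> n' = n \<and> qs' = qs"
  using assms
proof (induction arbitrary: v' n' qs' rule: eval.induct)
  case (eval_Var i env)
  from eval_Var.prems show ?case by cases auto
next
  case (eval_Leaf env)
  from eval_Leaf.prems show ?case by cases auto
next
  case (eval_Node env a u m qs b v n rs)
  from eval_Node.prems show ?case by cases (use eval_Node.IH in blast)
next
  case (eval_Case_Leaf env a m qs b v n rs c)
  from eval_Case_Leaf.prems show ?case by cases (use eval_Case_Leaf.IH in blast)+
next
  case (eval_Case_Node env a x y m qs c v n rs b)
  from eval_Case_Node.prems show ?case by cases (use eval_Case_Node.IH in blast)+
next
  case (eval_Bind env a u m qs b v n rs)
  from eval_Bind.prems show ?case by cases (use eval_Bind.IH in blast)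
next
  case (eval_Call f env a u m qs v n rs)
  from eval_Call.prems show ?case by cases (use eval_Call.IH in blast)
next
  case (eval_Query env a u m qs)
  from eval_Query.prems show ?case by cases (use eval_Query.IH in blast)
qed


section \<open>Encoding of instances\<close>

text \<open>Natural numbers are encoded in binary, least significant bit first.\<close>

fun enc_nat :: "nat \<Rightarrow> data" where
  "enc_nat n =
     (if n = 0 then Leaf
      else Node (if even n then Leaf else Node Leaf Leaf) (enc_nat (n div 2)))"

declare enc_nat.simps [simp del]

primrec enc_list :: "('a \<Rightarrow> data) \<Rightarrow> 'a list \<Rightarrow> data" where
  "enc_list f [] = Leaf"
| "enc_list f (x # xs) = Node (f x) (enc_list f xs)"

text \<open>
  Finite sets, edge sets and bags are listed without repetition and in an arbitrary order, so
  encodings are not unique.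
\<close>

definition encodes_set :: "data \<Rightarrow> nat set \<Rightarrow> bool" where
  "encodes_set d X \<longleftrightarrow> (\<exists>xs. distinct xs \<and> set xs = X \<and> d = enc_list enc_nat xs)"

definition encodes_edges :: "data \<Rightarrow> nat set set \<Rightarrow> bool" where
  "encodes_edges d E \<longleftrightarrow>
     (\<exists>es. distinct (map (\<lambda>(u, v). {u, v}) es) \<and> set (map (\<lambda>(u, v). {u, v}) es) = E \<and>
           d = enc_list (\<lambda>(u, v). Node (enc_nat u) (enc_nat v)) es)"

definition encodes_graph :: "data \<Rightarrow> nat graph \<Rightarrow> bool" where
  "encodes_graph d G \<longleftrightarrow>
     (\<exists>a b. d = Node a b \<and> encodes_set a (verts G) \<and> encodes_edges b (edges G))"

inductive encodes_rtree :: "data \<Rightarrow> nat set rtree \<Rightarrow> bool" where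
  "encodes_set b B \<Longrightarrow> list_all2 encodes_rtree ds ts \<Longrightarrow>
   encodes_rtree (Node b (enc_list (\<lambda>d. d) ds)) (Rooted B ts)"

definition encodes_instance :: "data \<Rightarrow> nat graph \<Rightarrow> nat set rtree \<Rightarrow> bool" where
  "encodes_instance d G t \<longleftrightarrow> (\<exists>a b. d = Node a b \<and> encodes_graph a G \<and> encodes_rtree b t)"


section \<open>Approximate Turing kernelization\<close>

definition ids_oracle :: "real \<Rightarrow> real \<Rightarrow> (data \<Rightarrow> data) \<Rightarrow> bool" where
  "ids_oracle c N orc \<longleftrightarrow>
     (\<forall>H d. simple_graph H \<and> real (card (verts H)) \<le> N \<and> encodes_graph d H \<longrightarrow>
        (\<exists>X. encodes_set (orc d) X \<and> approx_ids c H X))"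

text \<open>
  \<open>h\<close> bounds the number of vertices of the queries in terms of the treewidth and the maximum
  degree. Neither the program \<open>P\<close> nor its running time may depend on the approximation ratio \<open>c\<close>
  of the oracle. The output lists its elements without repetition, so its size is polynomial as
  well.
\<close>

definition ids_approx_turing_kernelization ::
  "real \<Rightarrow> (nat \<Rightarrow> nat \<Rightarrow> real) \<Rightarrow> expr list \<Rightarrow> bool" where
  "ids_approx_turing_kernelization \<alpha> h P \<longleftrightarrow>
     (\<exists>p :: nat poly. \<forall>G t d c orc.
        simple_graph G \<and> nice_tree_decomposition G t \<and>
        width (tree_graph t) (label_at t) = treewidth G \<and> encodes_instance d G t \<and>
        c \<ge> 1 \<and> ids_oracle c (h (treewidth G) (max_degree G)) orc \<longrightarrow>
        (\<exists>y n qs.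
           runs P orc d y n qs \<and> n \<le> poly p (size d) \<and>
           (\<forall>q\<in>set qs. \<exists>H. simple_graph H \<and> encodes_graph q H \<and>
              real (card (verts H)) \<le> h (treewidth G) (max_degree G)) \<and>
           (\<exists>X. encodes_set y X \<and> approx_ids (c * \<alpha>) G X)))"

end

theory Submission
  imports Defs
begin

text \<open>
  Suppose that deleting a set \<open>S\<close> splits the graph into parts without edges between them. Optimal
  solutions of the parts have total size at most \<open>opt + \<Delta> |S|\<close>, and the union of solutions of the
  parts extends greedily by at most \<open>|S|\<close> vertices to a solution of the whole graph. As
  \<open>opt \<ge> n / (\<Delta> + 1)\<close>, the additive error \<open>(\<Delta> + 1) |S|\<close> is at most \<open>\<epsilon> opt\<close> once
  \<open>K |S| \<le> n\<close> for \<open>K = k (\<Delta> + 1)\<^sup>2\<close> with \<open>k = \<lceil>1 / \<epsilon>\<rceil>\<close>. Such an \<open>S\<close> is found bottom-up in the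
  tree decomposition: the vertices met below a node are collected, and as soon as \<open>K |B|\<close> of them
  are pending at a node with bag \<open>B\<close>, the bag is added to \<open>S\<close> and the pending vertices become a part.
  A part is formed from two collections that were still below the threshold (or a bag), so it has at
  most \<open>2 K (tw + 1)\<close> vertices.
\<close>

section \<open>Deleting a separating set\<close>

text \<open>The obstacle is that independent domination is not monotone: a combined solution cannot
  be repaired afterwards, since adding a vertex may break independence and removing one may break
  domination. Leaving \<open>S\<close> out of every query avoids both. The answers for the parts are
  then jointly independent and dominate everything outside \<open>S\<close>, so the repair only ever
  adds vertices of \<open>S\<close>. The price is that the deletion can raise the optimum, because
  vertices lose their dominators in \<open>S\<close>; the maximum degree bounds how many do.

  Graphs without edges are a separate case. There \<Delta> = 0, so the allowed query size is 0 as
  well, and the program has to answer alone; the set of all vertices is the only solution. An edge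
  makes both \<Delta> and the treewidth positive, and only then can \<Delta> + 1 and tw + 1 be
  absorbed into a purely multiplicative bound.\<close>

definition induced :: "'a graph \<Rightarrow> 'a set \<Rightarrow> 'a graph" where
  "induced G A = Graph A {e \<in> edges G. e \<subseteq> A}"

lemma induced_simps [simp]:
  "verts (induced G A) = A" "edges (induced G A) = {e \<in> edges G. e \<subseteq> A}"
  by (simp_all add: induced_def)

lemma simple_graph_induced: "simple_graph G \<Longrightarrow> A \<subseteq> verts G \<Longrightarrow> simple_graph (induced G A)"
  by (auto simp: simple_graph_def intro: finite_subset)

lemma simple_graph_edgeD:
  assumes "simple_graph G" "{u, v} \<in> edges G"
  shows "u \<in> verts G" "v \<in> verts G" "u \<noteq> v"
  using assms by (auto simp: simple_graph_def card_2_iff)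

section \<open>Greedy extension of independent sets\<close>

primrec greedy :: "'a set set \<Rightarrow> 'a list \<Rightarrow> 'a set \<Rightarrow> 'a set" where
  "greedy E [] X = X"
| "greedy E (v # vs) X = greedy E vs (if \<exists>u\<in>X. {u, v} \<in> E then X else insert v X)"

lemma greedy_superset: "X \<subseteq> greedy E vs X"
proof (induction vs arbitrary: X)
  case (Cons v vs)
  show ?case using Cons[of X] Cons[of "insert v X"] by auto
qed simp

text \<open>Whatever \<open>X\<close> dominates stays dominated while the set grows, so a candidate
  enters only if \<open>X\<close> leaves it undominated. This counts the added vertices and also
  locates them.\<close>

lemma greedy_subset: "greedy (edges G) vs X \<subseteq> X \<union> (set vs - closed_nbhd G X)"
proof (induction vs arbitrary: X)
  case (Cons v vs)
  show ?case
    using Cons[of X] Cons[of "insert v X"] by (auto simp: closed_nbhd_def)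
qed simp

lemma independent_greedy:
  assumes "simple_graph G" "independent G X"
  shows "independent G (greedy (edges G) vs X)"
  using assms(2)
proof (induction vs arbitrary: X)
  case (Cons v vs)
  have "independent G (insert v X)" if "\<not> (\<exists>u\<in>X. {u, v} \<in> edges G)"
    using that Cons.prems simple_graph_edgeD(3)[OF assms(1)]
    unfolding independent_def by (metis insert_iff insert_commute)
  then show ?case using Cons by simp
qed simp

lemma greedy_dominates: "set vs \<subseteq> closed_nbhd G (greedy (edges G) vs X)"
proof (induction vs arbitrary: X)
  case (Cons v vs)
  let ?Y = "if \<exists>u\<in>X. {u, v} \<in> edges G then X else insert v X"
  have "v \<in> closed_nbhd G ?Y" by (auto simp: closed_nbhd_def)
  moreover have "?Y \<subseteq> greedy (edges G) vs ?Y" by (rule greedy_superset)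
  ultimately have "v \<in> closed_nbhd G (greedy (edges G) vs ?Y)"
    unfolding closed_nbhd_def by blast
  then show ?case using Cons[of ?Y] by simp
qed simp

text \<open>A candidate that is passed over has a neighbour in the set, so it suffices to offer the
  vertices that \<open>X\<close> leaves undominated. All vertices are offered when an arbitrary
  independent set is extended, and those of \<open>S\<close> when the parts are combined.\<close>

lemma ind_dom_set_greedy:
  assumes G: "simple_graph G" and X: "independent G X" "X \<subseteq> verts G"
    and vs: "set vs \<subseteq> verts G" and dom: "verts G \<subseteq> closed_nbhd G X \<union> set vs"
  shows "ind_dom_set G (greedy (edges G) vs X)"
proof -
  let ?Y = "greedy (edges G) vs X"
  have sub: "?Y \<subseteq> verts G" using greedy_subset[of G vs X] X vs by blast
  have "closed_nbhd G X \<subseteq> closed_nbhd G ?Y"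
    using greedy_superset[of X "edges G" vs] by (auto simp: closed_nbhd_def)
  then have "verts G \<subseteq> closed_nbhd G ?Y" using dom greedy_dominates[of vs G X] by blast
  moreover have "closed_nbhd G ?Y \<subseteq> verts G"
    using sub simple_graph_edgeD[OF G] by (auto simp: closed_nbhd_def)
  ultimately show ?thesis
    using sub independent_greedy[OF G X(1)] by (simp add: ind_dom_set_def)
qed

lemma independent_extends:
  assumes G: "simple_graph G" and X: "independent G X" "X \<subseteq> verts G"
  obtains Y where "ind_dom_set G Y" "X \<subseteq> Y" "Y - X \<subseteq> verts G - closed_nbhd G X"
proof -
  obtain vs where vs: "set vs = verts G"
    using G by (meson finite_list simple_graph_def)
  show ?thesis
    using that[OF ind_dom_set_greedy[OF G X, of vs] greedy_superset]
      greedy_subset[of G vs X] vs by blast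
qed

section \<open>Optimal solutions, and the cost of deleting a set\<close>

lemma ind_dom_set_finite: "simple_graph G \<Longrightarrow> ind_dom_set G X \<Longrightarrow> finite X"
  by (meson finite_subset ind_dom_set_def simple_graph_def)

lemma finite_ind_dom_sets: "simple_graph G \<Longrightarrow> finite {X. ind_dom_set G X}"
  by (rule finite_subset[of _ "Pow (verts G)"]) (auto simp: ind_dom_set_def simple_graph_def)

lemma ids_opt_le: "simple_graph G \<Longrightarrow> ind_dom_set G X \<Longrightarrow> ids_opt G \<le> card X"
  unfolding ids_opt_def by (rule Min_le) (auto intro: finite_ind_dom_sets)

text \<open>\<open>Min\<close> of an empty set would be unspecified. Solutions exist because the
  empty set extends to one.\<close>

lemma ids_opt_witness:
  assumes "simple_graph G"
  obtains X where "ind_dom_set G X" "card X = ids_opt G"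
proof -
  have "\<exists>X. ind_dom_set G X"
    by (rule independent_extends[OF assms, of "{}"]) (auto simp: independent_def)
  then have "ids_opt G \<in> card ` {X. ind_dom_set G X}"
    unfolding ids_opt_def using finite_ind_dom_sets[OF assms] by (intro Min_in) auto
  then show ?thesis using that by auto
qed

lemma vertex_degree_le: "simple_graph G \<Longrightarrow> v \<in> verts G \<Longrightarrow> vertex_degree G v \<le> max_degree G"
  unfolding max_degree_def by (rule Max_ge) (auto simp: simple_graph_def)

lemma finite_nbhd: "simple_graph G \<Longrightarrow> finite {u. {u, v} \<in> edges G}"
  by (rule finite_subset[of _ "verts G"]) (auto dest: simple_graph_edgeD simp: simple_graph_def)

lemma card_nbhds_le:
  assumes "simple_graph G" "S \<subseteq> verts G"
  shows "card (\<Union>v\<in>S. {u. {u, v} \<in> edges G}) \<le> max_degree G * card S"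
proof -
  have fin: "finite S" using assms by (meson finite_subset simple_graph_def)
  have "card (\<Union>v\<in>S. {u. {u, v} \<in> edges G}) \<le> (\<Sum>v\<in>S. vertex_degree G v)"
    unfolding vertex_degree_def by (rule card_UN_le[OF fin])
  also have "\<dots> \<le> (\<Sum>v\<in>S. max_degree G)"
    using assms by (intro sum_mono vertex_degree_le) auto
  finally show ?thesis by (simp add: mult.commute)
qed

lemma card_verts_le:
  assumes G: "simple_graph G" and X: "ind_dom_set G X"
  shows "card (verts G) \<le> (max_degree G + 1) * card X"
proof -
  have "verts G = X \<union> (\<Union>v\<in>X. {u. {u, v} \<in> edges G})"
    using X simple_graph_edgeD(1)[OF G]
    by (auto simp: ind_dom_set_def closed_nbhd_def insert_commute)
  then have "card (verts G) \<le> card X + card (\<Union>v\<in>X. {u. {u, v} \<in> edges G})"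
    by (metis card_Un_le)
  also have "\<dots> \<le> card X + max_degree G * card X"
    using card_nbhds_le[OF G] X by (simp add: ind_dom_set_def)
  finally show ?thesis by simp
qed

text \<open>
  What an optimal solution loses when \<open>S\<close> is deleted are the neighbours of \<open>S\<close>, which can be
  dominated by themselves.
\<close>

lemma ids_opt_delete_le:
  assumes G: "simple_graph G" and S: "S \<subseteq> verts G"
  shows "ids_opt (induced G (verts G - S)) \<le> ids_opt G + max_degree G * card S"
proof -
  let ?H = "induced G (verts G - S)"
  have H: "simple_graph ?H" using G by (simp add: simple_graph_induced)
  obtain Y where Y: "ind_dom_set G Y" "card Y = ids_opt G" by (rule ids_opt_witness[OF G])
  have "independent ?H (Y - S)" "Y - S \<subseteq> verts ?H"
    using Y(1) by (auto simp: ind_dom_set_def independent_def)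
  then obtain X where X: "ind_dom_set ?H X" "Y - S \<subseteq> X"
      "X - (Y - S) \<subseteq> verts ?H - closed_nbhd ?H (Y - S)"
    by (rule independent_extends[OF H])
  have new: "X - (Y - S) \<subseteq> (\<Union>v\<in>S. {u. {u, v} \<in> edges G})"
  proof
    fix x assume x: "x \<in> X - (Y - S)"
    then have x': "x \<in> verts G" "x \<notin> S" "x \<notin> closed_nbhd ?H (Y - S)" using X(3) by auto
    then have "x \<in> closed_nbhd G Y" using Y(1) by (simp add: ind_dom_set_def)
    then obtain y where y: "y \<in> Y" "{y, x} \<in> edges G"
      using x x' by (auto simp: closed_nbhd_def)
    \<comment> \<open>Otherwise \<open>y\<close> would belong to \<open>Y - S\<close> and its edge
      to \<open>x\<close> would survive in \<open>?H\<close>, where \<open>x\<close> is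
      undominated.\<close>
    then have "y \<in> S"
      using x' simple_graph_edgeD[OF G y(2)] by (auto simp: closed_nbhd_def)
    then show "x \<in> (\<Union>v\<in>S. {u. {u, v} \<in> edges G})"
      using y(2) by (auto simp: insert_commute)
  qed
  have finS: "finite S" using G S by (meson finite_subset simple_graph_def)
  have finX: "finite X" by (rule ind_dom_set_finite[OF H X(1)])
  have "ids_opt ?H \<le> card X" by (rule ids_opt_le[OF H X(1)])
  also have "\<dots> = card (Y - S) + card (X - (Y - S))"
    using X(2) finX by (metis card_Diff_subset finite_subset le_add_diff_inverse card_mono)
  also have "\<dots> \<le> card Y + max_degree G * card S"
  proof (intro add_mono)
    show "card (Y - S) \<le> card Y"
      using ind_dom_set_finite[OF G Y(1)] by (simp add: card_mono)
    have "card (X - (Y - S)) \<le> card (\<Union>v\<in>S. {u. {u, v} \<in> edges G})"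
      by (rule card_mono[OF _ new]) (use finS finite_nbhd[OF G] in auto)
    then show "card (X - (Y - S)) \<le> max_degree G * card S"
      using card_nbhds_le[OF G S] by simp
  qed
  finally show ?thesis using Y(2) by simp
qed

text \<open>Parts are disjoint as a whole, but only their vertices outside \<open>S\<close> are
  confined in their neighbours. \<open>sorted_wrt\<close> compares positions of a list, so the empty
  part may be repeated; cuts at empty bags can produce such parts.\<close>

definition separated_parts :: "'a graph \<Rightarrow> 'a set \<Rightarrow> 'a set list \<Rightarrow> bool" where
  "separated_parts G S Ps \<longleftrightarrow>
     sorted_wrt (\<lambda>P Q. P \<inter> Q = {}) Ps \<and>
     (\<forall>P\<in>set Ps. \<forall>u\<in>P - S. \<forall>v. {u, v} \<in> edges G \<longrightarrow> v \<in> P \<union> S)"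

lemma card_Int_Union_disjoint:
  assumes "finite Y" "sorted_wrt (\<lambda>P Q. P \<inter> Q = {}) Ps"
  shows "(\<Sum>P\<leftarrow>Ps. card (Y \<inter> P)) = card (Y \<inter> \<Union>(set Ps))"
  using assms(2)
proof (induction Ps)
  case (Cons P Ps)
  have "(Y \<inter> P) \<inter> (Y \<inter> \<Union>(set Ps)) = {}" using Cons.prems by auto
  then have "card ((Y \<inter> P) \<union> (Y \<inter> \<Union>(set Ps))) = card (Y \<inter> P) + card (Y \<inter> \<Union>(set Ps))"
    using assms(1) by (intro card_Un_disjoint) auto
  then show ?case using Cons by (simp add: Int_Un_distrib)
qed simp

text \<open>Once \<open>S\<close> is deleted no edge leaves a part, so the trace of an optimal
  solution on each part solves that part, and the disjoint traces add up to the solution.\<close>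

lemma sum_ids_opt_parts_le:
  assumes G: "simple_graph G" and S: "S \<subseteq> verts G"
    and Ps: "separated_parts G S Ps" "\<Union>(set Ps) = verts G"
  shows "(\<Sum>P\<leftarrow>Ps. ids_opt (induced G (P - S))) \<le> ids_opt (induced G (verts G - S))"
proof -
  let ?H = "induced G (verts G - S)"
  have H: "simple_graph ?H" using G by (simp add: simple_graph_induced)
  obtain Y where Y: "ind_dom_set ?H Y" "card Y = ids_opt ?H" by (rule ids_opt_witness[OF H])
  have "ids_opt (induced G (P - S)) \<le> card (Y \<inter> P)" if P: "P \<in> set Ps" for P
  proof (rule ids_opt_le)
    show "simple_graph (induced G (P - S))"
      using P Ps(2) by (intro simple_graph_induced G) auto
    have "P - S \<subseteq> closed_nbhd (induced G (P - S)) (Y \<inter> P)"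
    proof
      fix x assume x: "x \<in> P - S"
      then have "x \<in> closed_nbhd ?H Y" using Y(1) P Ps(2) by (auto simp: ind_dom_set_def)
      then consider "x \<in> Y" | y where "y \<in> Y" "{y, x} \<in> edges G" "y \<notin> S"
        using Y(1) by (auto simp: closed_nbhd_def)
      then show "x \<in> closed_nbhd (induced G (P - S)) (Y \<inter> P)"
      proof cases
        case 2
        then have "y \<in> P" using Ps(1) x P unfolding separated_parts_def
          by (metis UnE insert_commute)
        then show ?thesis using 2 x by (auto simp: closed_nbhd_def)
      qed (use x in \<open>auto simp: closed_nbhd_def\<close>)
    qed
    then show "ind_dom_set (induced G (P - S)) (Y \<inter> P)"
      using Y(1) simple_graph_edgeD[OF G]
      by (auto simp: ind_dom_set_def independent_def closed_nbhd_def)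
  qed
  then have "(\<Sum>P\<leftarrow>Ps. ids_opt (induced G (P - S))) \<le> (\<Sum>P\<leftarrow>Ps. card (Y \<inter> P))"
    by (rule sum_list_mono)
  also have "\<dots> = card (Y \<inter> verts G)"
    using card_Int_Union_disjoint[OF ind_dom_set_finite[OF H Y(1)]] Ps
    by (simp add: separated_parts_def)
  also have "Y \<inter> verts G = Y" using Y(1) by (auto simp: ind_dom_set_def)
  finally show ?thesis using Y(2) by simp
qed

text \<open>An edge between two chosen vertices would put one of them into the part of the other; by
  disjointness both then come from the same part, whose solution is independent.\<close>

lemma union_of_part_solutions:
  assumes Ps: "separated_parts G S Ps" "\<Union>(set Ps) = verts G"
    and Xs: "list_all2 (\<lambda>P X. ind_dom_set (induced G (P - S)) X) Ps Xs"
  shows "independent G (\<Union>(set Xs))" "\<Union>(set Xs) \<subseteq> verts G - S"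
    "verts G - S \<subseteq> closed_nbhd G (\<Union>(set Xs))"
proof -
  have in_X: "\<exists>P\<in>set Ps. ind_dom_set (induced G (P - S)) X" if "X \<in> set Xs" for X
    using that Xs by (metis in_set_conv_nth list_all2_conv_all_nth)
  have in_P: "\<exists>X\<in>set Xs. ind_dom_set (induced G (P - S)) X" if "P \<in> set Ps" for P
    using that Xs by (metis in_set_conv_nth list_all2_conv_all_nth)
  have disj: "i = j" if "x \<in> Ps ! i" "x \<in> Ps ! j" "i < length Ps" "j < length Ps" for i j x
    using that Ps(1) unfolding separated_parts_def sorted_wrt_iff_nth_less
    by (metis IntI empty_iff linorder_neqE_nat)
  show "\<Union>(set Xs) \<subseteq> verts G - S"
    using in_X Ps(2) by (fastforce simp: ind_dom_set_def)
  show "independent G (\<Union>(set Xs))"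
    unfolding independent_def
  proof (intro ballI notI)
    fix u v assume uv: "u \<in> \<Union>(set Xs)" "v \<in> \<Union>(set Xs)" "{u, v} \<in> edges G"
    obtain i where i: "i < length Ps" "u \<in> Xs ! i" "ind_dom_set (induced G (Ps ! i - S)) (Xs ! i)"
      using uv(1) Xs by (auto simp: list_all2_conv_all_nth in_set_conv_nth)
    obtain j where j: "j < length Ps" "v \<in> Xs ! j" "ind_dom_set (induced G (Ps ! j - S)) (Xs ! j)"
      using uv(2) Xs by (auto simp: list_all2_conv_all_nth in_set_conv_nth)
    have u: "u \<in> Ps ! i - S" and v: "v \<in> Ps ! j - S" using i j by (auto simp: ind_dom_set_def)
    have "v \<in> Ps ! i" using Ps(1) u v i(1) uv(3) unfolding separated_parts_def
      by (metis DiffD2 UnE nth_mem)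
    then have "i = j" using disj[of v i j] v i j by auto
    then show False using i j u v uv(3) by (auto simp: ind_dom_set_def independent_def)
  qed
  show "verts G - S \<subseteq> closed_nbhd G (\<Union>(set Xs))"
  proof
    fix x assume x: "x \<in> verts G - S"
    then obtain P where P: "P \<in> set Ps" "x \<in> P" using Ps(2) by auto
    then obtain X where X: "X \<in> set Xs" "ind_dom_set (induced G (P - S)) X" using in_P by blast
    then have "x \<in> closed_nbhd (induced G (P - S)) X" using P x by (auto simp: ind_dom_set_def)
    then show "x \<in> closed_nbhd G (\<Union>(set Xs))" using X(1) by (auto simp: closed_nbhd_def)
  qed
qed

lemma sum_list_scaled_le:
  fixes c :: real
  assumes "list_all2 (\<lambda>P X. real (g X) \<le> c * real (f P)) Ps Xs"
  shows "real (\<Sum>X\<leftarrow>Xs. g X) \<le> c * real (\<Sum>P\<leftarrow>Ps. f P)"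
  using assms by (induction rule: list_all2_induct) (auto simp: distrib_left)

lemma card_Union_le_sum_list: "card (\<Union>(set Xs)) \<le> (\<Sum>X\<leftarrow>Xs. card X)"
proof (induction Xs)
  case (Cons X Xs)
  then show ?case using card_Un_le[of X "\<Union>(set Xs)"] by simp
qed simp

lemma greedy_approx_ids:
  fixes c \<epsilon> :: real and k :: nat
  assumes G: "simple_graph G" and vs: "set vs = S" "S \<subseteq> verts G"
    and Ps: "separated_parts G S Ps" "\<Union>(set Ps) = verts G"
    and Xs: "list_all2 (\<lambda>P X. approx_ids c (induced G (P - S)) X) Ps Xs"
    and S: "k * (max_degree G + 1)\<^sup>2 * card S \<le> card (verts G)"
    and c: "c \<ge> 1" and eps: "\<epsilon> * real k \<ge> 1" "\<epsilon> > 0"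
  shows "approx_ids (c * (1 + \<epsilon>)) G (greedy (edges G) vs (\<Union>(set Xs)))"
proof -
  let ?X = "\<Union>(set Xs)" and ?\<Delta> = "max_degree G" and ?opt = "ids_opt G"
  let ?Y = "greedy (edges G) vs ?X"
  have Xs': "list_all2 (\<lambda>P X. ind_dom_set (induced G (P - S)) X) Ps Xs"
    using Xs by (rule list_all2_mono) (simp add: approx_ids_def)
  note un = union_of_part_solutions[OF Ps Xs']
  have Y: "ind_dom_set G ?Y"
    by (rule ind_dom_set_greedy[OF G un(1)]) (use un vs in auto)
  have fin: "finite (verts G)" using G by (simp add: simple_graph_def)
  then have finS: "finite S" "finite ?X" using vs un(2) by (auto intro: finite_subset)
  have "real (card ?X) \<le> real (\<Sum>X\<leftarrow>Xs. card X)" using card_Union_le_sum_list[of Xs] by simp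
  also have "\<dots> \<le> c * real (\<Sum>P\<leftarrow>Ps. ids_opt (induced G (P - S)))"
    by (rule sum_list_scaled_le, rule list_all2_mono[OF Xs]) (simp add: approx_ids_def)
  also have "\<dots> \<le> c * real (?opt + ?\<Delta> * card S)"
    using sum_ids_opt_parts_le[OF G vs(2) Ps] ids_opt_delete_le[OF G vs(2)] c
    by (intro mult_left_mono of_nat_mono) auto
  finally have X: "real (card ?X) \<le> c * real (?opt + ?\<Delta> * card S)" .
  obtain Z where Z: "ind_dom_set G Z" "card Z = ?opt" by (rule ids_opt_witness[OF G])
  \<comment> \<open>This is where the square in \<open>K\<close> is spent: one factor \<Delta> + 1
    cancels against the bound on the number of vertices, the other one remains to pay for an error
    of \<Delta> + 1 per vertex of \<open>S\<close>.\<close>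
  have "(?\<Delta> + 1) * (k * (?\<Delta> + 1) * card S) \<le> (?\<Delta> + 1) * ?opt"
    using S card_verts_le[OF G Z(1)] Z(2) by (simp add: power2_eq_square algebra_simps)
  then have "k * (?\<Delta> + 1) * card S \<le> ?opt"
    by (metis add_gr_0 less_one mult_le_cancel1)
  then have "real k * (real (?\<Delta> + 1) * real (card S)) \<le> real ?opt"
    by (metis of_nat_le_iff of_nat_mult mult.assoc)
  then have "\<epsilon> * (real k * (real (?\<Delta> + 1) * real (card S))) \<le> \<epsilon> * real ?opt"
    using eps(2) by (intro mult_left_mono) auto
  moreover have "1 * (real (?\<Delta> + 1) * real (card S))
      \<le> (\<epsilon> * real k) * (real (?\<Delta> + 1) * real (card S))"
    using eps(1) by (intro mult_right_mono) auto
  ultimately have opt: "real (?\<Delta> + 1) * real (card S) \<le> \<epsilon> * real ?opt"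
    by (simp only: mult.assoc mult_1)
  have "?Y \<subseteq> ?X \<union> S" using greedy_subset[of G vs ?X] vs by blast
  then have "card ?Y \<le> card ?X + card S"
    by (meson card_Un_le card_mono finS finite_UnI le_trans)
  then have "real (card ?Y) \<le> c * real (?opt + ?\<Delta> * card S) + 1 * real (card S)" using X by simp
  \<comment> \<open>The greedily added vertices cost 1 each whatever the oracle does. Charging them
    at the rate \<open>c \<ge> 1\<close> lets \<open>c\<close> factor out, so that \<open>S\<close>
    can be chosen without knowing it.\<close>
  also have "\<dots> \<le> c * real (?opt + ?\<Delta> * card S) + c * real (card S)"
    using c by (intro add_left_mono mult_right_mono) auto
  also have "\<dots> = c * (real ?opt + real (?\<Delta> + 1) * real (card S))" by (simp add: algebra_simps)
  also have "\<dots> \<le> c * (real ?opt + \<epsilon> * real ?opt)"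
    using opt c by (intro mult_left_mono add_left_mono) auto
  finally show ?thesis using Y by (simp add: approx_ids_def algebra_simps)
qed

section \<open>Cutting a tree decomposition\<close>

text \<open>The separation property of bags in a form that follows the recursion of the cutting
  procedure, so that walks in the tree are dealt with once, in
  \<open>separated_tree_subtree\<close>.\<close>

fun separated_tree :: "'a set set \<Rightarrow> 'a set rtree \<Rightarrow> bool" where
  "separated_tree E (Rooted B ts) \<longleftrightarrow>
     (\<forall>s\<in>set ts. separated_tree E s \<and>
        (\<forall>u \<in> \<Union>(set_rtree s) - B. \<forall>v. {u, v} \<in> E \<longrightarrow> v \<in> \<Union>(set_rtree s)))"

lemma subtree_at_append:
  "subtree_at t (p @ q) = Option.bind (subtree_at t p) (\<lambda>s. subtree_at s q)"
  by (induction t p rule: subtree_at.induct) auto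

lemma set_rtree_eq_labels: "set_rtree t = {label_at t p | p. subtree_at t p \<noteq> None}"
proof (induction t)
  case (Rooted B ts)
  show ?case (is "_ = ?R")
  proof (intro equalityI subsetI)
    fix X assume "X \<in> set_rtree (Rooted B ts)"
    then consider "X = B" | s where "s \<in> set ts" "X \<in> set_rtree s" by auto
    then show "X \<in> ?R"
    proof cases
      case 1
      then show ?thesis by (intro CollectI exI[of _ "[]"]) (simp add: label_at_def)
    next
      case 2
      then obtain p where p: "X = label_at s p" "subtree_at s p \<noteq> None" using Rooted by blast
      obtain i where "i < length ts" "ts ! i = s" using 2 by (auto simp: in_set_conv_nth)
      then show ?thesis using p by (intro CollectI exI[of _ "i # p"]) (simp add: label_at_def)
    qed
  next
    fix X assume "X \<in> ?R"
    then obtain p where p: "X = label_at (Rooted B ts) p" "subtree_at (Rooted B ts) p \<noteq> None"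
      by blast
    show "X \<in> set_rtree (Rooted B ts)"
    proof (cases p)
      case Nil
      then show ?thesis using p by (simp add: label_at_def)
    next
      case (Cons i q)
      then have "i < length ts" "X = label_at (ts ! i) q" "subtree_at (ts ! i) q \<noteq> None"
        using p by (auto simp: label_at_def split: if_splits)
      then show ?thesis using Rooted[OF nth_mem] by force
    qed
  qed
qed

text \<open>The edge between \<open>p\<close> and \<open>p @ [i]\<close> is the only one that leaves
  the subtree at \<open>p @ [i]\<close>.\<close>

lemma walk_stays_below:
  assumes "successively (\<lambda>u v. {u, v} \<in> edges (tree_graph t)) xs"
    and "xs \<noteq> []" "\<exists>q. hd xs = (p @ [i]) @ q" "p \<notin> set xs" "x \<in> set xs"
  shows "\<exists>q. x = (p @ [i]) @ q"
  using assms
proof (induction xs rule: induct_list012)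
  case (3 a b xs)
  obtain q where q: "a = (p @ [i]) @ q" using 3 by auto
  have "{a, b} \<in> edges (tree_graph t)" using 3 by simp
  then obtain c j where cj: "{a, b} = {c, c @ [j]}" by (auto simp: tree_graph_def)
  then consider "b = a @ [j]" | "a = b @ [j]" by (auto simp: doubleton_eq_iff)
  then have b: "\<exists>q. b = (p @ [i]) @ q"
  proof cases
    case 1
    then show ?thesis using q by auto
  next
    case 2
    show ?thesis
    proof (cases q rule: rev_cases)
      case Nil
      then have "b = p" using 2 q by simp
      then show ?thesis using 3 by simp
    next
      case (snoc q' j')
      then have "b = (p @ [i]) @ q'" using 2 q by simp
      then show ?thesis by blast
    qed
  qed
  show ?case
  proof (cases "x = a")
    case True
    then show ?thesis using q by blast
  next
    case False
    then show ?thesis using "3.IH"(2) "3.prems" b by auto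
  qed
qed auto

text \<open>If \<open>u\<close> occurs below a child but not in the parent's bag, then the connected
  set of nodes containing \<open>u\<close> avoids the parent and stays below the child. A bag
  covering an edge at \<open>u\<close> is among these nodes. The address \<open>p\<close> varies in
  the induction on the subtree.\<close>

lemma separated_tree_subtree:
  assumes T: "tree_decomposition G (tree_graph t) (label_at t)"
  shows "subtree_at t p = Some s \<Longrightarrow> separated_tree (edges G) s"
proof (induction s arbitrary: p)
  case (Rooted B ts)
  have "separated_tree (edges G) s \<and>
        (\<forall>u \<in> \<Union>(set_rtree s) - B. \<forall>v. {u, v} \<in> edges G \<longrightarrow> v \<in> \<Union>(set_rtree s))"
    if s: "s \<in> set ts" for s
  proof (intro conjI ballI allI impI)
    obtain i where i: "i < length ts" "s = ts ! i" using s by (auto simp: in_set_conv_nth)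
    have at: "subtree_at t ((p @ [i]) @ q) = subtree_at s q" for q
      using Rooted.prems i by (simp add: subtree_at_append)
    have "subtree_at t (p @ [i]) = Some s" using at[of "[]"] by simp
    with Rooted.IH[OF s] show "separated_tree (edges G) s" by blast
    fix u v assume u: "u \<in> \<Union>(set_rtree s) - B" and uv: "{u, v} \<in> edges G"
    obtain q where q: "subtree_at s q \<noteq> None" "u \<in> label_at s q"
      using u by (auto simp: set_rtree_eq_labels)
    obtain r where r: "subtree_at t r \<noteq> None" "{u, v} \<subseteq> label_at t r"
      using T uv by (fastforce simp: tree_decomposition_def tree_graph_def)
    let ?S = "{x \<in> verts (tree_graph t). u \<in> label_at t x}"
    have q': "(p @ [i]) @ q \<in> ?S"
      using q at[of q] by (simp add: tree_graph_def label_at_def)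
    have r': "r \<in> ?S" using r by (simp add: tree_graph_def)
    have "u \<in> verts G" using T q' unfolding tree_decomposition_def by blast
    then have "connected_in (tree_graph t) ?S" using T by (simp add: tree_decomposition_def)
    then obtain xs where xs: "walk (tree_graph t) xs"
        "set xs \<subseteq> ?S" "hd xs = (p @ [i]) @ q" "last xs = r"
      using q' r' unfolding connected_in_def by meson
    have "p \<notin> set xs" using xs(2) u Rooted.prems by (auto simp: label_at_def)
    moreover have "r \<in> set xs" using xs by (metis last_in_set walk_def)
    ultimately obtain q'' where q'': "r = (p @ [i]) @ q''"
      using walk_stays_below[of t xs p i r] xs by (auto simp: walk_def)
    then have "label_at s q'' = label_at t r" "subtree_at s q'' \<noteq> None"
      using r at[of q''] by (simp_all add: label_at_def)
    then show "v \<in> \<Union>(set_rtree s)" using r(2) by (auto simp: set_rtree_eq_labels)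
  qed
  then show ?case by simp
qed

text \<open>
  \<open>W\<close> holds the vertices collected at the current node, \<open>S\<close> the deleted bags, \<open>Ps\<close> the parts and \<open>R\<close>
  their union. Parts may contain vertices of \<open>S\<close>. Measuring only \<open>W \<union> W' - R\<close> makes every cut
  enlarge \<open>R\<close> by at least \<open>K * card B\<close>, which gives \<open>K * card S \<le> card R\<close>.
\<close>

definition cut :: "nat \<Rightarrow> 'a set \<Rightarrow> 'a set \<Rightarrow> 'a set \<times> 'a set \<times> 'a set \<times> 'a set list \<Rightarrow>
    'a set \<times> 'a set \<times> 'a set \<times> 'a set list" where
  "cut K B W = (\<lambda>(W', S, R, Ps).
     let U = W \<union> W'; Q = U - R
     in if K * card B \<le> card Q then ({}, S \<union> B, R \<union> Q, Q # Ps) else (U, S, R, Ps))"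

text \<open>A child starts with its own bag pending, and its result is merged with \<open>W\<close>
  before the next sibling is treated. Testing after every single merge is what keeps a part within
  two bounded collections, however many children a node has.\<close>

fun cut_forest :: "nat \<Rightarrow> 'a set \<Rightarrow> 'a set rtree list \<Rightarrow> 'a set \<times> 'a set \<times> 'a set \<times> 'a set list \<Rightarrow>
    'a set \<times> 'a set \<times> 'a set \<times> 'a set list" where
  "cut_forest K B [] (W, st) = (W, st)"
| "cut_forest K B (Rooted B' ts' # ts) (W, st) =
     cut_forest K B ts (cut K B W (cut_forest K B' ts' (B', st)))"

text \<open>\<open>L\<close> stands for a common bound on \<open>K * card B\<close> over all bags,
  and thereby on the pending vertices outside \<open>R\<close>; a part arises from two such
  collections, hence \<open>2 * L\<close>.\<close>

definition cut_inv :: "'a graph \<Rightarrow> nat \<Rightarrow> nat \<Rightarrow> 'a set \<times> 'a set \<times> 'a set list \<Rightarrow> bool" where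
  "cut_inv G K L = (\<lambda>(S, R, Ps).
     S \<subseteq> R \<and> R \<subseteq> verts G \<and> \<Union>(set Ps) = R \<and> separated_parts G S Ps \<and>
     (\<forall>P\<in>set Ps. card P \<le> 2 * L) \<and> K * card S \<le> card R)"

text \<open>\<open>Z\<close> is everything met at the node once the child is merged, and only
  \<open>B\<close> connects it with the rest of the graph. Hence a neighbour of the new part outside
  \<open>B\<close> lies in the part itself or in \<open>R\<close>. In \<open>R\<close> it must
  belong to \<open>S\<close>: otherwise it lies in an old part, whose separation would already have
  put \<open>u\<close> into \<open>R\<close>.\<close>

lemma cut_invariant:
  assumes G: "simple_graph G" and inv: "cut_inv G K L (S, R, Ps)"
    and B: "B \<subseteq> Z" and Z: "Z \<subseteq> verts G" "\<And>u v. u \<in> Z - B \<Longrightarrow> {u, v} \<in> edges G \<Longrightarrow> v \<in> Z"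
    and U: "W \<union> W' \<subseteq> Z" "Z \<subseteq> (W \<union> W') \<union> R" "card (W - R) \<le> L" "card (W' - R) \<le> L"
    and KB: "K * card B \<le> L"
    and res: "cut K B W (W', S, R, Ps) = (W1, S1, R1, Ps1)"
  shows "cut_inv G K L (S1, R1, Ps1)" "W1 \<subseteq> Z" "Z \<subseteq> W1 \<union> R1" "R \<subseteq> R1" "card (W1 - R1) \<le> L"
proof -
  define Q where "Q = W \<union> W' - R"
  have finV: "finite (verts G)" using G by (simp add: simple_graph_def)
  have RV: "R \<subseteq> verts G" and SR: "S \<subseteq> R" and PsR: "\<Union>(set Ps) = R" and KS: "K * card S \<le> card R"
    using inv by (auto simp: cut_inv_def)
  have fin: "finite R" "finite Q" "finite B" "finite S"
    using finV RV U Z(1) B SR unfolding Q_def by (meson finite_subset Diff_subset order_trans)+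
  have QR: "Q \<inter> R = {}" by (auto simp: Q_def)
  have "Q = (W - R) \<union> (W' - R)" by (auto simp: Q_def)
  then have cardQ: "card Q \<le> 2 * L" using card_Un_le[of "W - R" "W' - R"] U by simp
  have "cut_inv G K L (S1, R1, Ps1) \<and> W1 \<subseteq> Z \<and> Z \<subseteq> W1 \<union> R1 \<and> R \<subseteq> R1 \<and> card (W1 - R1) \<le> L"
  proof (cases "K * card B \<le> card Q")
    case True
    \<comment> \<open>Nothing stays pending, not even the bag. Its vertices are in \<open>R1\<close>
      now, so \<open>Z \<subseteq> W1 \<union> R1\<close> is preserved.\<close>
    then have eq: "W1 = {}" "S1 = S \<union> B" "R1 = R \<union> Q" "Ps1 = Q # Ps"
      using res by (simp_all add: cut_def Q_def Let_def)
    have ZQR: "Z \<subseteq> Q \<union> R" using U(2) by (auto simp: Q_def)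
    have nb: "v \<in> Q \<union> (S \<union> B)" if u: "u \<in> Q - (S \<union> B)" and uv: "{u, v} \<in> edges G" for u v
    proof -
      have "u \<in> Z - B" using u U(1) by (auto simp: Q_def)
      then have "v \<in> Q \<union> R" using Z(2)[OF _ uv] ZQR by blast
      moreover have "v \<in> S" if "v \<in> R"
      proof (rule ccontr)
        assume "v \<notin> S"
        then obtain P where P: "P \<in> set Ps" "v \<in> P - S" using \<open>v \<in> R\<close> PsR by auto
        then have "u \<in> P \<union> S" using inv uv
          unfolding cut_inv_def separated_parts_def by (auto simp: insert_commute)
        then show False using u P(1) PsR SR QR by auto
      qed
      ultimately show ?thesis by blast
    qed
    have "separated_parts G (S \<union> B) (Q # Ps)"
      using inv nb QR PsR unfolding cut_inv_def separated_parts_def by auto blast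
    moreover have "K * card (S \<union> B) \<le> card (R \<union> Q)"
    proof -
      have "K * card (S \<union> B) \<le> K * card S + K * card B"
        using card_Un_le[of S B] by (metis distrib_left mult_le_mono2)
      also have "\<dots> \<le> card R + card Q" using True KS by simp
      also have "\<dots> = card (R \<union> Q)" using QR fin by (subst card_Un_disjoint) auto
      finally show ?thesis .
    qed
    moreover have "S \<union> B \<subseteq> R \<union> Q" using SR B ZQR by auto
    moreover have "R \<union> Q \<subseteq> verts G" using RV U(1) Z(1) by (auto simp: Q_def)
    ultimately show ?thesis
      using inv eq ZQR cardQ by (auto simp: cut_inv_def)
  next
    case False
    \<comment> \<open>Below the threshold there are fewer than \<open>K * card B\<close> pending
      vertices outside \<open>R\<close>, hence at most \<open>L\<close>.\<close>
    then have "W1 = W \<union> W'" "S1 = S" "R1 = R" "Ps1 = Ps"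
      using res by (simp_all add: cut_def Q_def Let_def)
    then show ?thesis using False inv U KB by (auto simp: Q_def)
  qed
  then show "cut_inv G K L (S1, R1, Ps1)" "W1 \<subseteq> Z" "Z \<subseteq> W1 \<union> R1" "R \<subseteq> R1" "card (W1 - R1) \<le> L"
    by auto
qed

text \<open>Here \<open>Z\<close> is the set of all vertices met so far at the current node.\<close>

lemma cut_forest_invariant:
  assumes G: "simple_graph G" and K: "K \<ge> 1"
  shows "cut_inv G K L (S, R, Ps) \<Longrightarrow> separated_tree (edges G) (Rooted B ts) \<Longrightarrow>
    B \<subseteq> Z \<Longrightarrow> Z \<union> \<Union>(\<Union>(set_rtree ` set ts)) \<subseteq> verts G \<Longrightarrow>
    (\<And>u v. u \<in> Z - B \<Longrightarrow> {u, v} \<in> edges G \<Longrightarrow> v \<in> Z) \<Longrightarrow>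
    W \<subseteq> Z \<Longrightarrow> Z \<subseteq> W \<union> R \<Longrightarrow> card (W - R) \<le> L \<Longrightarrow>
    (\<And>X. X \<in> set_rtree (Rooted B ts) \<Longrightarrow> K * card X \<le> L) \<Longrightarrow>
    cut_forest K B ts (W, S, R, Ps) = (W1, S1, R1, Ps1) \<Longrightarrow>
    cut_inv G K L (S1, R1, Ps1) \<and> Z \<union> \<Union>(\<Union>(set_rtree ` set ts)) \<subseteq> W1 \<union> R1 \<and>
    W1 \<subseteq> Z \<union> \<Union>(\<Union>(set_rtree ` set ts)) \<and> R \<subseteq> R1 \<and> card (W1 - R1) \<le> L"
proof (induction ts arbitrary: B Z W S R Ps W1 S1 R1 Ps1
    rule: measure_induct_rule[of "size_list size"])
  case (less fs)
  note pre = less.prems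
  show ?case
  proof (cases fs)
    case Nil
    then show ?thesis using pre by auto
  next
    case (Cons t ts)
    obtain B' ts' where t: "t = Rooted B' ts'" by (cases t)
    have finV: "finite (verts G)" using G by (simp add: simple_graph_def)
    obtain W2 S2 R2 Ps2 where r2: "cut_forest K B' ts' (B', S, R, Ps) = (W2, S2, R2, Ps2)"
      by (metis prod_cases4)
    obtain W3 S3 R3 Ps3 where r3: "cut K B W (W2, S2, R2, Ps2) = (W3, S3, R3, Ps3)"
      by (metis prod_cases4)
    have r1: "cut_forest K B ts (W3, S3, R3, Ps3) = (W1, S1, R1, Ps1)"
      using pre(10) by (simp add: Cons t r2 r3)
    let ?V = "\<Union>(set_rtree t)"
    have V: "?V = B' \<union> \<Union>(\<Union>(set_rtree ` set ts'))" by (auto simp: t)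
    have bags: "X \<in> set_rtree (Rooted B' ts') \<Longrightarrow> K * card X \<le> L"
        "X \<in> set_rtree (Rooted B ts) \<Longrightarrow> K * card X \<le> L" for X
      by (rule pre(9), force simp: Cons t)+
    have KB': "K * card B' \<le> L" by (rule pre(9)) (simp add: Cons t)
    have B'V: "B' \<subseteq> verts G" using pre(4) by (auto simp: Cons t)
    \<comment> \<open>The child's bag is its first pending set; \<open>K \<ge> 1\<close> turns the
      bound on \<open>K * card B'\<close> into one on the bag itself.\<close>
    have "card (B' - R) \<le> card B'" using B'V finV by (meson card_mono Diff_subset finite_subset)
    then have B'L: "card (B' - R) \<le> L" using KB' K
      by (metis le_trans mult_le_mono1 mult_1)
    \<comment> \<open>For the child, \<open>B'\<close> plays the role of both \<open>Z\<close> and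
      the bag, so the condition on neighbours is vacuous at the start.\<close>
    have IH1: "cut_inv G K L (S2, R2, Ps2) \<and> ?V \<subseteq> W2 \<union> R2 \<and> W2 \<subseteq> ?V \<and> R \<subseteq> R2 \<and> card (W2 - R2) \<le> L"
      unfolding V
      by (rule less.IH[OF _ pre(1) _ _ _ _ _ _ B'L bags(1) r2])
         (use pre(2,4) in \<open>auto simp: Cons t\<close>)
    have sub: "card (W - R2) \<le> L"
    proof -
      have "W - R2 \<subseteq> W - R" "finite (W - R)"
        using IH1 pre(4,6) finV by (auto intro: finite_subset)
      then show ?thesis using pre(8) by (meson card_mono le_trans)
    qed
    have nb: "v \<in> Z \<union> ?V" if "u \<in> Z \<union> ?V - B" "{u, v} \<in> edges G" for u v
    proof (cases "u \<in> Z")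
      case True
      then show ?thesis using that pre(5)[of u v] by auto
    next
      case False
      then show ?thesis using that pre(2) by (auto simp: Cons)
    qed
    have inv2: "cut_inv G K L (S2, R2, Ps2)" and BZ: "B \<subseteq> Z \<union> ?V"
      and ZV: "Z \<union> ?V \<subseteq> verts G" and KB: "K * card B \<le> L"
      and U: "W \<union> W2 \<subseteq> Z \<union> ?V" "Z \<union> ?V \<subseteq> W \<union> W2 \<union> R2" "card (W2 - R2) \<le> L"
      using IH1 pre(3,4,6,7) bags(2)[of B] by (auto simp: Cons)
    have cut: "cut_inv G K L (S3, R3, Ps3)" "W3 \<subseteq> Z \<union> ?V" "Z \<union> ?V \<subseteq> W3 \<union> R3" "R2 \<subseteq> R3"
        "card (W3 - R3) \<le> L"
      by (rule cut_invariant[OF G inv2 BZ ZV nb U(1,2) sub U(3) KB r3]; assumption)+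
    have "cut_inv G K L (S1, R1, Ps1) \<and> (Z \<union> ?V) \<union> \<Union>(\<Union>(set_rtree ` set ts)) \<subseteq> W1 \<union> R1 \<and>
       W1 \<subseteq> (Z \<union> ?V) \<union> \<Union>(\<Union>(set_rtree ` set ts)) \<and> R3 \<subseteq> R1 \<and> card (W1 - R1) \<le> L"
      by (rule less.IH[OF _ cut(1) _ _ _ nb cut(2,3,5) bags(2) r1])
         (use pre(2-4) in \<open>auto simp: Cons t\<close>)
    then show ?thesis using IH1 cut(4) by (auto simp: Cons)
  qed
qed

section \<open>The program\<close>

text \<open>
  Truth values are encoded by \<open>Leaf\<close> (false) and any \<open>Node\<close> (true). A filter function takes
  \<open>Node context list\<close> and calls its test on \<open>Node context element\<close>; a fold takes
  \<open>Node context (Node accumulator list)\<close> and calls its step on \<open>Node context (Node accumulator element)\<close>.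
  A branch \<open>Mk_Leaf\<close> of a \<open>Case\<close> that only destructs a pair is never taken.
\<close>

abbreviation "True_expr \<equiv> Mk_Node Mk_Leaf Mk_Leaf"

definition filter_body :: "nat \<Rightarrow> nat \<Rightarrow> expr" where
  "filter_body self test =
     Case (Var 0) Mk_Leaf (Case (Var 1) Mk_Leaf
       (Case (Call test (Mk_Node (Var 2) (Var 0)))
         (Call self (Mk_Node (Var 2) (Var 1)))
         (Mk_Node (Var 2) (Call self (Mk_Node (Var 4) (Var 3))))))"

definition fold_body :: "nat \<Rightarrow> nat \<Rightarrow> expr" where
  "fold_body self step =
     Case (Var 0) Mk_Leaf (Case (Var 1) Mk_Leaf (Case (Var 1) (Var 0)
       (Call self (Mk_Node (Var 4)
         (Mk_Node (Call step (Mk_Node (Var 4) (Mk_Node (Var 2) (Var 0)))) (Var 1))))))"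

text \<open>Written \<open>Suc 0\<close> because simplification turns \<open>1 :: nat\<close> into
  this form.\<close>

abbreviation (input) "eq_ix \<equiv> Suc 0"
abbreviation (input) "mem_ix \<equiv> 2 :: nat"
abbreviation (input) "or_ix \<equiv> 3 :: nat"
abbreviation (input) "union_ix \<equiv> 4 :: nat"
abbreviation (input) "not_ix \<equiv> 5 :: nat"
abbreviation (input) "diff_ix \<equiv> 6 :: nat"
abbreviation (input) "inside_ix \<equiv> 7 :: nat"
abbreviation (input) "induce_ix \<equiv> 8 :: nat"
abbreviation (input) "incident_ix \<equiv> 9 :: nat"
abbreviation (input) "star_ix \<equiv> 10 :: nat"
abbreviation (input) "leq_ix \<equiv> 11 :: nat"
abbreviation (input) "degree_ix \<equiv> 12 :: nat"
abbreviation (input) "max_degree_ix \<equiv> 13 :: nat"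
abbreviation (input) "cons_ix \<equiv> 14 :: nat"
abbreviation (input) "append_ix \<equiv> 15 :: nat"
abbreviation (input) "add_ix \<equiv> 16 :: nat"
abbreviation (input) "mult_ix \<equiv> 17 :: nat"
abbreviation (input) "forest_ix \<equiv> 18 :: nat"
abbreviation (input) "cut_ix \<equiv> 19 :: nat"
abbreviation (input) "query_ix \<equiv> 20 :: nat"
abbreviation (input) "solve_ix \<equiv> 21 :: nat"
abbreviation (input) "touch_ix \<equiv> 22 :: nat"
abbreviation (input) "touches_ix \<equiv> 23 :: nat"
abbreviation (input) "extend_ix \<equiv> 24 :: nat"
abbreviation (input) "greedy_ix \<equiv> 25 :: nat"

definition eq_body :: expr where
  "eq_body =
     Case (Var 0) Mk_Leaf (Case (Var 0)
       (Case (Var 1) True_expr Mk_Leaf)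
       (Case (Var 3) Mk_Leaf
         (Case (Call eq_ix (Mk_Node (Var 2) (Var 0))) Mk_Leaf
           (Call eq_ix (Mk_Node (Var 5) (Var 3))))))"

text \<open>The context is a pair of sets. A union filters the vertex list of the graph by this
  test, so it has no repetitions and cannot outgrow that list.\<close>

definition or_body :: expr where
  "or_body =
     Case (Var 0) Mk_Leaf (Case (Var 0) Mk_Leaf
       (Case (Call mem_ix (Mk_Node (Var 3) (Var 0)))
         (Call mem_ix (Mk_Node (Var 3) (Var 1))) True_expr))"

definition not_body :: expr where
  "not_body =
     Case (Var 0) Mk_Leaf (Case (Call mem_ix (Mk_Node (Var 1) (Var 0))) True_expr Mk_Leaf)"

definition inside_body :: expr where
  "inside_body =
     Case (Var 0) Mk_Leaf (Case (Var 1) Mk_Leaf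
       (Case (Call mem_ix (Mk_Node (Var 0) (Var 2))) Mk_Leaf
         (Call mem_ix (Mk_Node (Var 3) (Var 4)))))"

definition incident_body :: expr where
  "incident_body =
     Case (Var 0) Mk_Leaf (Case (Var 1) Mk_Leaf
       (Case (Call eq_ix (Mk_Node (Var 2) (Var 0)))
         (Call eq_ix (Mk_Node (Var 2) (Var 1))) True_expr))"

text \<open>Numbers are represented in unary, as lengths of lists with arbitrary entries. The
  cardinality of a set is then the list of its elements, without any conversion.\<close>

definition leq_body :: expr where
  "leq_body =
     Case (Var 0) Mk_Leaf (Case (Var 0) True_expr
       (Case (Var 3) Mk_Leaf (Call leq_ix (Mk_Node (Var 3) (Var 1)))))"

text \<open>The accumulator is the longest list of incident edges found so far, which serves
  directly as the unary maximum degree.\<close>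

definition degree_body :: expr where
  "degree_body =
     Case (Var 0) Mk_Leaf (Case (Var 1) Mk_Leaf
       (Bind (Call star_ix (Mk_Node (Var 1) (Var 2)))
         (Case (Call leq_ix (Mk_Node (Var 0) (Var 1))) (Var 0) (Var 3))))"

definition cons_body :: expr where
  "cons_body = Case (Var 0) Mk_Leaf (Case (Var 1) Mk_Leaf (Mk_Node (Var 1) (Var 0)))"

definition add_body :: expr where
  "add_body =
     Case (Var 0) Mk_Leaf (Case (Var 1) Mk_Leaf
       (Call append_ix (Mk_Node Mk_Leaf (Mk_Node (Var 0) (Var 2)))))"

text \<open>The context holds the vertex list, which unions filter, and the factor \<open>K\<close>
  in unary. A child's bag is passed twice: as its bag and as its initial pending set.\<close>

definition forest_body :: expr where
  "forest_body =
     Case (Var 0) Mk_Leaf (Case (Var 1) Mk_Leaf (Case (Var 1) Mk_Leaf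
       (Case (Var 0) (Var 1) (Case (Var 0) Mk_Leaf (Case (Var 5) Mk_Leaf
         (Call forest_ix (Mk_Node (Var 10) (Mk_Node (Var 8) (Mk_Node (Var 5)
           (Call cut_ix (Mk_Node (Var 10) (Mk_Node (Var 8) (Mk_Node (Var 0)
             (Call forest_ix (Mk_Node (Var 10) (Mk_Node (Var 2) (Mk_Node (Var 3)
               (Mk_Node (Var 2) (Var 1)))))))))))))))))))"

definition cut_body :: expr where
  "cut_body =
     Case (Var 0) Mk_Leaf (Case (Var 0) Mk_Leaf (Case (Var 3) Mk_Leaf (Case (Var 1) Mk_Leaf
       (Case (Var 1) Mk_Leaf (Case (Var 1) Mk_Leaf (Case (Var 1) Mk_Leaf
         (Bind (Call union_ix (Mk_Node (Mk_Node (Var 6) (Var 4)) (Var 10)))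
         (Bind (Call diff_ix (Mk_Node (Var 1) (Var 0)))
         (Case (Call leq_ix
                 (Mk_Node (Call mult_ix (Mk_Node (Var 10) (Mk_Node Mk_Leaf (Var 13)))) (Var 0)))
           (Mk_Node (Var 1) (Var 7))
           (Mk_Node Mk_Leaf
             (Mk_Node (Call union_ix (Mk_Node (Mk_Node (Var 6) (Var 12)) (Var 14)))
               (Mk_Node (Call union_ix (Mk_Node (Mk_Node (Var 4) (Var 2)) (Var 14)))
                 (Mk_Node (Var 2) (Var 5))))))))))))))"

text \<open>Solutions of different parts are disjoint, so appending the answer to the accumulator
  yields their union without repetitions.\<close>

definition query_body :: expr where
  "query_body =
     Case (Var 0) Mk_Leaf (Case (Var 0) Mk_Leaf (Case (Var 3) Mk_Leaf
       (Bind (Call diff_ix (Mk_Node (Var 2) (Var 1)))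
         (Call append_ix (Mk_Node Mk_Leaf (Mk_Node (Var 1)
           (Query (Mk_Node (Var 0) (Call induce_ix (Mk_Node (Var 0) (Var 4)))))))))))"

text \<open>An edge is listed in one orientation only, so \<open>v\<close> is looked for at both
  ends.\<close>

definition touch_body :: expr where
  "touch_body =
     Case (Var 0) Mk_Leaf (Case (Var 0) Mk_Leaf (Case (Var 3) Mk_Leaf
       (Case (Case (Call eq_ix (Mk_Node (Var 2) (Var 0))) Mk_Leaf
               (Call mem_ix (Mk_Node (Var 3) (Var 5))))
         (Case (Call eq_ix (Mk_Node (Var 2) (Var 1))) Mk_Leaf
           (Call mem_ix (Mk_Node (Var 2) (Var 5))))
         True_expr)))"

definition extend_body :: expr where
  "extend_body =
     Case (Var 0) Mk_Leaf (Case (Var 1) Mk_Leaf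
       (Case (Call touches_ix (Mk_Node (Mk_Node (Var 1) (Var 0)) (Var 2)))
         (Mk_Node (Var 1) (Var 0)) (Var 2)))"

primrec unary :: "nat \<Rightarrow> expr" where
  "unary 0 = Mk_Leaf"
| "unary (Suc k) = Mk_Node Mk_Leaf (unary k)"

text \<open>The constant \<open>k\<close> is built in, as it depends on \<epsilon> alone. An empty
  edge list is answered at once with the vertex list. A \<open>Mk_Node Mk_Leaf\<close> in front of
  the maximum degree produces \<Delta> + 1, and the vertices outside \<open>R\<close> become one
  more part.\<close>

definition main_body :: "nat \<Rightarrow> expr" where
  "main_body k =
     Case (Var 0) Mk_Leaf (Case (Var 0) Mk_Leaf (Case (Var 1) (Var 0) (Case (Var 5) Mk_Leaf
       (Bind (Mk_Node Mk_Leaf (Call max_degree_ix (Mk_Node (Var 5) (Mk_Node Mk_Leaf (Var 4)))))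
       (Bind (Call mult_ix (Mk_Node (Var 0) (Mk_Node Mk_Leaf
               (Call mult_ix (Mk_Node (Var 0) (Mk_Node Mk_Leaf (unary k)))))))
       (Case (Call forest_ix (Mk_Node (Mk_Node (Var 6) (Var 0)) (Mk_Node (Var 2) (Mk_Node (Var 3)
               (Mk_Node (Var 2) (Mk_Node Mk_Leaf (Mk_Node Mk_Leaf Mk_Leaf))))))) Mk_Leaf
         (Case (Var 1) Mk_Leaf (Case (Var 1) Mk_Leaf
           (Call greedy_ix (Mk_Node (Var 13) (Mk_Node
             (Call solve_ix (Mk_Node (Mk_Node (Var 2) (Var 13))
               (Mk_Node Mk_Leaf (Mk_Node (Call diff_ix (Mk_Node (Var 0) (Var 12))) (Var 1)))))
             (Var 2))))))))))))"

definition prog :: "nat \<Rightarrow> expr list" where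
  "prog k =
     [main_body k, eq_body, filter_body mem_ix eq_ix, or_body, filter_body union_ix or_ix,
      not_body, filter_body diff_ix not_ix, inside_body, filter_body induce_ix inside_ix,
      incident_body, filter_body star_ix incident_ix, leq_body, degree_body,
      fold_body max_degree_ix degree_ix, cons_body, fold_body append_ix cons_ix, add_body,
      fold_body mult_ix add_ix, forest_body, cut_body, query_body, fold_body solve_ix query_ix,
      touch_body, filter_body touches_ix touch_ix, extend_body, fold_body greedy_ix extend_ix]"

section \<open>Running the program\<close>

primrec dlen :: "data \<Rightarrow> nat" where
  "dlen Leaf = 0"
| "dlen (Node a b) = Suc (dlen b)"

lemma dlen_enc_list [simp]: "dlen (enc_list f xs) = length xs"
  by (induction xs) auto

text \<open>Any tree can be read along its right spine. This makes the unary operations total, so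
  that \<open>call_fold\<close> applies to them without assumptions on the data.\<close>

lemma data_as_list: "\<exists>xs. d = enc_list (\<lambda>d. d) xs"
proof (induction d)
  case Leaf
  show ?case by (intro exI[of _ "[]"]) simp
next
  case (Node a b)
  then obtain xs where "b = enc_list (\<lambda>d. d) xs" by blast
  then show ?case by (intro exI[of _ "a # xs"]) simp
qed

lemma enc_list_eq_Leaf_iff: "enc_list f xs = Leaf \<longleftrightarrow> xs = []"
  by (cases xs) auto

lemma length_le_size_enc_list: "length xs \<le> size (enc_list f xs)"
  by (induction xs) auto

lemma size_le_size_enc_list: "x \<in> set xs \<Longrightarrow> size (f x) \<le> size (enc_list f xs)"
  by (induction xs) auto

lemma size_enc_list: "size (enc_list f xs) = (\<Sum>x\<leftarrow>xs. size (f x) + 1)"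
  by (induction xs) auto

text \<open>The size does not depend on the order of the entries. Hence the vertex list of the input
  bounds the encoding of every set of vertices, in whatever order it is listed.\<close>

lemma size_enc_list_mono:
  assumes "distinct xs" "set xs \<subseteq> set ys"
  shows "size (enc_list f xs) \<le> size (enc_list f ys)"
proof -
  have "size (enc_list f xs) = (\<Sum>x\<in>set xs. size (f x) + 1)"
    using assms(1) by (simp add: size_enc_list sum_list_distinct_conv_sum_set)
  also have "\<dots> \<le> (\<Sum>x\<in>set ys. size (f x) + 1)" using assms(2) by (intro sum_mono2) auto
  also have "\<dots> \<le> size (enc_list f ys)"
    unfolding size_enc_list
  proof (induction ys)
    case (Cons y ys)
    then show ?case by (cases "y \<in> set ys") (auto simp: insert_absorb)
  qed simp
  finally show ?thesis .
qed

lemma enc_nat_inject [simp]: "enc_nat m = enc_nat n \<longleftrightarrow> m = n"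
proof
  show "enc_nat m = enc_nat n \<Longrightarrow> m = n"
  proof (induction m arbitrary: n rule: less_induct)
    case (less m)
    show ?case
    proof (cases "m = 0 \<or> n = 0")
      case True
      then show ?thesis using less.prems by (auto simp: enc_nat.simps[of m] enc_nat.simps[of n]
          split: if_splits)
    next
      case False
      then have "even m \<longleftrightarrow> even n" "enc_nat (m div 2) = enc_nat (n div 2)"
        using less.prems by (auto simp: enc_nat.simps[of m] enc_nat.simps[of n] split: if_splits)
      then have "m mod 2 = n mod 2" "m div 2 = n div 2"
        using less.IH[of "m div 2" "n div 2"] False by (auto simp: mod2_eq_if)
      then show ?thesis by (metis div_mult_mod_eq)
    qed
  qed
qed simp

section \<open>Weakest preconditions for the program\<close>

locale program =
  fixes k :: nat and orc :: "data \<Rightarrow> data" and ok :: "data \<Rightarrow> bool"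
begin

text \<open>The admissible queries \<open>ok\<close> are fixed by the locale, so the restriction on
  queries is part of every call and postconditions speak of value and time only.\<close>

definition call :: "nat \<Rightarrow> data \<Rightarrow> (data \<Rightarrow> nat \<Rightarrow> bool) \<Rightarrow> bool" where
  "call f u \<Phi> \<longleftrightarrow> f < length (prog k) \<and>
     (\<exists>v n qs. eval (prog k) orc [u] (prog k ! f) v n qs \<and> (\<forall>q\<in>set qs. ok q) \<and> \<Phi> v n)"

text \<open>
  Weakest preconditions: the postcondition relates the value and the time. \<open>call\<close> stays opaque
  inside \<open>wp\<close>, so that the simplifier executes a function body without unfolding recursive calls.
\<close>

primrec wp :: "expr \<Rightarrow> data list \<Rightarrow> (data \<Rightarrow> nat \<Rightarrow> bool) \<Rightarrow> bool" where
  "wp (Var i) env \<Phi> \<longleftrightarrow> i < length env \<and> \<Phi> (env ! i) 1"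
| "wp Mk_Leaf env \<Phi> \<longleftrightarrow> \<Phi> Leaf 1"
| "wp (Mk_Node a b) env \<Phi> \<longleftrightarrow>
     wp a env (\<lambda>u m. wp b env (\<lambda>v n. \<Phi> (Node u v) (m + n + 1)))"
| "wp (Case a b c) env \<Phi> \<longleftrightarrow> wp a env (\<lambda>u m.
     case u of Leaf \<Rightarrow> wp b env (\<lambda>v n. \<Phi> v (m + n + 1))
     | Node x y \<Rightarrow> wp c (x # y # env) (\<lambda>v n. \<Phi> v (m + n + 1)))"
| "wp (Bind a b) env \<Phi> \<longleftrightarrow> wp a env (\<lambda>u m. wp b (u # env) (\<lambda>v n. \<Phi> v (m + n + 1)))"
| "wp (Call f a) env \<Phi> \<longleftrightarrow> wp a env (\<lambda>u m. call f u (\<lambda>v n. \<Phi> v (m + n + 1)))"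
| "wp (Query a) env \<Phi> \<longleftrightarrow> wp a env (\<lambda>u m. ok u \<and> \<Phi> (orc u) (m + size u + 1))"

lemma call_mono: "call f u \<Phi> \<Longrightarrow> (\<And>v n. \<Phi> v n \<Longrightarrow> \<Psi> v n) \<Longrightarrow> call f u \<Psi>"
  unfolding call_def by blast

text \<open>Induction on the expression suffices although the program is recursive, since
  \<open>call\<close> already contains an evaluation of the called body. Recursion is dealt with
  function by function, by induction on the data.\<close>

lemma wp_sound:
  "wp e env \<Phi> \<Longrightarrow> \<exists>v n qs. eval (prog k) orc env e v n qs \<and> (\<forall>q\<in>set qs. ok q) \<and> \<Phi> v n"
proof (induction e arbitrary: env \<Phi>)
  case (Var i)
  then have "eval (prog k) orc env (Var i) (env ! i) 1 []" "\<Phi> (env ! i) 1"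
    using eval_Var[of i env] by simp_all
  then show ?case by fastforce
next
  case Mk_Leaf
  then have "eval (prog k) orc env Mk_Leaf Leaf 1 []" "\<Phi> Leaf 1"
    using eval_Leaf[of _ _ env] by simp_all
  then show ?case by fastforce
next
  case (Mk_Node a b)
  obtain u m qs where a: "eval (prog k) orc env a u m qs" "\<forall>q\<in>set qs. ok q"
    and wb: "wp b env (\<lambda>v n. \<Phi> (Node u v) (m + n + 1))"
    using Mk_Node.IH(1)[OF Mk_Node.prems[unfolded wp.simps]] by blast
  obtain v n rs where b: "eval (prog k) orc env b v n rs"
      "\<forall>q\<in>set rs. ok q" "\<Phi> (Node u v) (m + n + 1)"
    using Mk_Node.IH(2)[OF wb] by blast
  have "\<forall>q\<in>set (qs @ rs). ok q" using a b by auto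
  then show ?case using eval_Node[OF a(1) b(1)] b(3) by blast
next
  case (Case a b c)
  obtain u m qs where a: "eval (prog k) orc env a u m qs" "\<forall>q\<in>set qs. ok q"
    and wb: "case u of Leaf \<Rightarrow> wp b env (\<lambda>v n. \<Phi> v (m + n + 1))
      | Node x y \<Rightarrow> wp c (x # y # env) (\<lambda>v n. \<Phi> v (m + n + 1))"
    using Case.IH(1)[OF Case.prems[unfolded wp.simps]] by blast
  show ?case
  proof (cases u)
    case Leaf
    then obtain v n rs where b: "eval (prog k) orc env b v n rs" "\<forall>q\<in>set rs. ok q" "\<Phi> v (m + n + 1)"
      using Case.IH(2) wb by fastforce
    have "\<forall>q\<in>set (qs @ rs). ok q" using a b by auto
    then show ?thesis using eval_Case_Leaf[OF a(1)[unfolded Leaf] b(1)] b(3) by blast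
  next
    case (Node x y)
    then obtain v n rs where b: "eval (prog k) orc (x # y # env) c v n rs" "\<forall>q\<in>set rs. ok q"
        "\<Phi> v (m + n + 1)"
      using Case.IH(3) wb by fastforce
    have "\<forall>q\<in>set (qs @ rs). ok q" using a b by auto
    then show ?thesis using eval_Case_Node[OF a(1)[unfolded Node] b(1)] b(3) by blast
  qed
next
  case (Bind a b)
  obtain u m qs where a: "eval (prog k) orc env a u m qs" "\<forall>q\<in>set qs. ok q"
    and wb: "wp b (u # env) (\<lambda>v n. \<Phi> v (m + n + 1))"
    using Bind.IH(1)[OF Bind.prems[unfolded wp.simps]] by blast
  obtain v n rs where b: "eval (prog k) orc (u # env) b v n rs" "\<forall>q\<in>set rs. ok q" "\<Phi> v (m + n + 1)"
    using Bind.IH(2)[OF wb] by blast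
  have "\<forall>q\<in>set (qs @ rs). ok q" using a b by auto
  then show ?case using eval_Bind[OF a(1) b(1)] b(3) by blast
next
  case (Call f a)
  obtain u m qs where a: "eval (prog k) orc env a u m qs" "\<forall>q\<in>set qs. ok q"
    and wb: "call f u (\<lambda>v n. \<Phi> v (m + n + 1))"
    using Call.IH[OF Call.prems[unfolded wp.simps]] by blast
  obtain v n rs where b: "f < length (prog k)" "eval (prog k) orc [u] (prog k ! f) v n rs"
      "\<forall>q\<in>set rs. ok q" "\<Phi> v (m + n + 1)"
    using wb unfolding call_def by blast
  have "\<forall>q\<in>set (qs @ rs). ok q" using a b by auto
  then show ?case using eval_Call[OF b(1) a(1) b(2)] b(4) by blast
next
  case (Query a)
  obtain u m qs where a: "eval (prog k) orc env a u m qs" "\<forall>q\<in>set qs. ok q"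
    and b: "ok u" "\<Phi> (orc u) (m + size u + 1)"
    using Query.IH[OF Query.prems[unfolded wp.simps]] by blast
  have "\<forall>q\<in>set (qs @ [u]). ok q" using a b by auto
  then show ?case using eval_Query[OF a(1)] b(2) by blast
qed

lemma wp_unary [simp]: "wp (unary m) env \<Phi> \<longleftrightarrow> \<Phi> ((Node Leaf ^^ m) Leaf) (2 * m + 1)"
  by (induction m arbitrary: \<Phi>) auto

lemma callI: "f < length (prog k) \<Longrightarrow> wp (prog k ! f) [u] \<Phi> \<Longrightarrow> call f u \<Phi>"
  unfolding call_def using wp_sound by blast

lemma call_0: "wp (main_body k) [u] \<Phi> \<Longrightarrow> call 0 u \<Phi>"
  and call_eq_ix: "wp eq_body [u] \<Phi> \<Longrightarrow> call eq_ix u \<Phi>"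
  and call_or_ix: "wp or_body [u] \<Phi> \<Longrightarrow> call or_ix u \<Phi>"
  and call_not_ix: "wp not_body [u] \<Phi> \<Longrightarrow> call not_ix u \<Phi>"
  and call_inside_ix: "wp inside_body [u] \<Phi> \<Longrightarrow> call inside_ix u \<Phi>"
  and call_incident_ix: "wp incident_body [u] \<Phi> \<Longrightarrow> call incident_ix u \<Phi>"
  and call_leq_ix: "wp leq_body [u] \<Phi> \<Longrightarrow> call leq_ix u \<Phi>"
  and call_degree_ix: "wp degree_body [u] \<Phi> \<Longrightarrow> call degree_ix u \<Phi>"
  and call_cons_ix: "wp cons_body [u] \<Phi> \<Longrightarrow> call cons_ix u \<Phi>"
  and call_add_ix: "wp add_body [u] \<Phi> \<Longrightarrow> call add_ix u \<Phi>"
  and call_forest_ix: "wp forest_body [u] \<Phi> \<Longrightarrow> call forest_ix u \<Phi>"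
  and call_cut_ix: "wp cut_body [u] \<Phi> \<Longrightarrow> call cut_ix u \<Phi>"
  and call_query_ix: "wp query_body [u] \<Phi> \<Longrightarrow> call query_ix u \<Phi>"
  and call_touch_ix: "wp touch_body [u] \<Phi> \<Longrightarrow> call touch_ix u \<Phi>"
  and call_extend_ix: "wp extend_body [u] \<Phi> \<Longrightarrow> call extend_ix u \<Phi>"
  by (rule callI; simp add: prog_def)+

section \<open>Filters, folds and unary arithmetic\<close>

lemma call_filter:
  assumes prog: "i < length (prog k) \<and> prog k ! i = filter_body i j"
    and test: "\<And>x. x \<in> set xs \<Longrightarrow> call j (Node c (f x)) (\<lambda>v n. (v \<noteq> Leaf \<longleftrightarrow> p x) \<and> n \<le> \<tau>)"
  shows "call i (Node c (enc_list f xs))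
    (\<lambda>v n. v = enc_list f (filter p xs) \<and> n \<le> (length xs + 1) * (\<tau> + 20))"
proof -
  have body: "wp (filter_body i j) [u] \<Phi> \<Longrightarrow> call i u \<Phi>" for u \<Phi>
    using prog by (intro callI) auto
  show ?thesis
    using test
  proof (induction xs)
    case Nil
    show ?case by (rule body) (simp add: filter_body_def)
  next
    case (Cons x xs)
    have IH: "call i (Node c (enc_list f xs))
        (\<lambda>v n. v = enc_list f (filter p xs) \<and> n \<le> (length xs + 1) * (\<tau> + 20))"
      using Cons by simp
    have x: "call j (Node c (f x)) (\<lambda>v n. (v \<noteq> Leaf \<longleftrightarrow> p x) \<and> n \<le> \<tau>)"
      using Cons.prems by simp
    show ?case
      by (rule body, cases "p x"; simp add: filter_body_def; intro call_mono[OF x])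
        (auto split: data.split intro!: call_mono[OF IH])
  qed
qed

text \<open>\<open>Inv\<close> takes the elements still to come, so an invariant can compare the
  rest of the fold with the final result and carry assumptions about unprocessed elements.\<close>

lemma call_fold:
  assumes prog: "i < length (prog k) \<and> prog k ! i = fold_body i j"
    and step: "\<And>x xs a. Inv (x # xs) a \<Longrightarrow>
      call j (Node c (Node a (f x))) (\<lambda>v n. Inv xs v \<and> n \<le> \<tau>)"
    and "Inv xs a"
  shows "call i (Node c (Node a (enc_list f xs)))
    (\<lambda>v n. Inv [] v \<and> n \<le> (length xs + 1) * (\<tau> + 20))"
proof -
  have body: "wp (fold_body i j) [u] \<Phi> \<Longrightarrow> call i u \<Phi>" for u \<Phi>
    using prog by (intro callI) auto
  show ?thesis
    using assms(3)
  proof (induction xs arbitrary: a)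
    case Nil
    then show ?case by (intro body) (simp add: fold_body_def)
  next
    case (Cons x xs)
    show ?case
      apply (rule body)
      apply (simp add: fold_body_def)
      apply (rule call_mono[OF step[OF Cons.prems]])
      apply (auto intro!: call_mono[OF Cons.IH])
      done
  qed
qed

lemma call_filter_ixs:
  "mem_ix < length (prog k) \<and> prog k ! mem_ix = filter_body mem_ix eq_ix"
  "union_ix < length (prog k) \<and> prog k ! union_ix = filter_body union_ix or_ix"
  "diff_ix < length (prog k) \<and> prog k ! diff_ix = filter_body diff_ix not_ix"
  "induce_ix < length (prog k) \<and> prog k ! induce_ix = filter_body induce_ix inside_ix"
  "star_ix < length (prog k) \<and> prog k ! star_ix = filter_body star_ix incident_ix"
  "touches_ix < length (prog k) \<and> prog k ! touches_ix = filter_body touches_ix touch_ix"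
  by (simp_all add: prog_def)

lemma call_fold_ixs:
  "max_degree_ix < length (prog k) \<and> prog k ! max_degree_ix = fold_body max_degree_ix degree_ix"
  "append_ix < length (prog k) \<and> prog k ! append_ix = fold_body append_ix cons_ix"
  "mult_ix < length (prog k) \<and> prog k ! mult_ix = fold_body mult_ix add_ix"
  "solve_ix < length (prog k) \<and> prog k ! solve_ix = fold_body solve_ix query_ix"
  "greedy_ix < length (prog k) \<and> prog k ! greedy_ix = fold_body greedy_ix extend_ix"
  by (simp_all add: prog_def)

lemma call_eq:
  "call eq_ix (Node x y) (\<lambda>v n. (v \<noteq> Leaf \<longleftrightarrow> x = y) \<and> n \<le> 40 * size x + 20)"
proof (induction x arbitrary: y)
  case Leaf
  show ?case by (cases y) (rule call_eq_ix; simp add: eq_body_def)+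
next
  case (Node x1 x2)
  show ?case
  proof (cases y)
    case Leaf
    then show ?thesis by (intro call_eq_ix) (simp add: eq_body_def)
  next
    case y: (Node y1 y2)
    show ?thesis
      unfolding y
      apply (rule call_eq_ix)
      apply (simp add: eq_body_def)
      apply (rule call_mono[OF Node(1)])
      apply (auto split: data.split intro!: call_mono[OF Node(2)])
      done
  qed
qed

lemma call_leq:
  "call leq_ix (Node x y) (\<lambda>v n. (v \<noteq> Leaf \<longleftrightarrow> dlen x \<le> dlen y) \<and> n \<le> 20 * dlen x + 20)"
proof (induction x arbitrary: y)
  case Leaf
  show ?case by (rule call_leq_ix) (simp add: leq_body_def)
next
  case (Node x1 x2)
  show ?case
    by (rule call_leq_ix, cases y; simp add: leq_body_def; intro call_mono[OF Node(2)]) auto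
qed

lemma call_append:
  "call append_ix (Node c (Node (enc_list f ys) (enc_list f xs)))
     (\<lambda>v n. v = enc_list f (rev xs @ ys) \<and> n \<le> (length xs + 1) * 30)"
proof -
  have "call append_ix (Node c (Node (enc_list f ys) (enc_list f xs)))
     (\<lambda>v n. (\<exists>zs. v = enc_list f zs \<and> rev [] @ zs = rev xs @ ys) \<and> n \<le> (length xs + 1) * (10 + 20))"
    by (rule call_fold[where Inv = "\<lambda>us a. \<exists>zs. a = enc_list f zs \<and> rev us @ zs = rev xs @ ys"
          and j = cons_ix, OF call_fold_ixs(2)])
      (auto intro!: call_cons_ix simp: cons_body_def simp flip: enc_list.simps(2))
  then show ?thesis by (rule call_mono) auto
qed

lemma call_append_dlen:
  "call append_ix (Node c (Node a b)) (\<lambda>v n. dlen v = dlen b + dlen a \<and> n \<le> (dlen b + 1) * 30)"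
proof -
  obtain xs ys where a: "a = enc_list (\<lambda>d. d) ys" and b: "b = enc_list (\<lambda>d. d) xs"
    by (metis data_as_list)
  show ?thesis unfolding a b
    by (rule call_mono[OF call_append]) simp
qed

lemma call_mult:
  "call mult_ix (Node b (Node Leaf a))
     (\<lambda>v n. dlen v = dlen a * dlen b \<and> n \<le> (dlen a + 1) * ((dlen b + 1) * 30 + 40))"
proof -
  obtain xs where a: "a = enc_list (\<lambda>d. d) xs"
    by (metis data_as_list)
  \<comment> \<open>The invariant adds what the remaining elements will contribute, which avoids
    subtraction.\<close>
  have "call mult_ix (Node b (Node Leaf (enc_list (\<lambda>d. d) xs)))
     (\<lambda>v n. dlen v + length ([] :: data list) * dlen b = length xs * dlen b \<and>
        n \<le> (length xs + 1) * ((dlen b + 1) * 30 + 20 + 20))"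
  proof (rule call_fold[where j = add_ix, OF call_fold_ixs(3)])
    fix x d :: data and ys :: "data list"
    assume *: "dlen d + length (x # ys) * dlen b = length xs * dlen b"
    show "call add_ix (Node b (Node d x))
      (\<lambda>v n. dlen v + length ys * dlen b = length xs * dlen b \<and> n \<le> (dlen b + 1) * 30 + 20)"
      by (rule call_add_ix, simp add: add_body_def, rule call_mono[OF call_append_dlen])
        (use * in auto)
  qed simp
  then show ?thesis unfolding a by (rule call_mono) simp
qed

end

section \<open>Subroutines on the input graph\<close>

definition enc_edge :: "nat \<times> nat \<Rightarrow> data" where
  "enc_edge = (\<lambda>(u, v). Node (enc_nat u) (enc_nat v))"

text \<open>
  Running times for lists of at most \<open>N\<close> elements of size at most \<open>N\<close>; the constants are generous.
\<close>

definition t_eq :: "nat \<Rightarrow> nat" where "t_eq N = 40 * N + 20"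
definition t_mem :: "nat \<Rightarrow> nat" where "t_mem N = (N + 1) * (t_eq N + 20)"
definition t_union :: "nat \<Rightarrow> nat" where "t_union N = (N + 1) * (2 * t_mem N + 50)"
definition t_star :: "nat \<Rightarrow> nat" where "t_star N = (N + 1) * (2 * t_eq N + 50)"
definition t_degree :: "nat \<Rightarrow> nat" where "t_degree N = (N + 1) * (t_star N + 20 * N + 80)"
definition t_mult :: "nat \<Rightarrow> nat \<Rightarrow> nat" where "t_mult N K = (K + 1) * ((N + 1) * 30 + 40)"
definition t_cut :: "nat \<Rightarrow> nat \<Rightarrow> nat" where
  "t_cut N K = 4 * t_union N + t_mult N K + 20 * K * N + 120"
definition t_query :: "nat \<Rightarrow> nat" where "t_query N = 2 * t_union N + 40 * N + 120"
definition t_touches :: "nat \<Rightarrow> nat" where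
  "t_touches N = (N + 1) * (2 * t_eq N + 2 * t_mem N + 60)"

text \<open>\<open>vl\<close> and \<open>el\<close> are the listings found in the input. The
  inequality is strict because a query puts one \<open>Node\<close> on top of a vertex list and an
  edge list and should still have size at most \<open>N\<close>.\<close>

locale program_on_graph = program +
  fixes G :: "nat graph" and vl :: "nat list" and el :: "(nat \<times> nat) list" and N :: nat
  assumes G: "simple_graph G"
    and vl: "distinct vl" "set vl = verts G"
    and el: "distinct (map (\<lambda>(u, v). {u, v}) el)" "set (map (\<lambda>(u, v). {u, v}) el) = edges G"
    and N: "size (enc_list enc_nat vl) + size (enc_list enc_edge el) < N"
begin

text \<open>Containment in \<open>verts G\<close> bounds the length and size of all these lists by
  \<open>N\<close>, including the answers of the oracle.\<close>

definition vset :: "data \<Rightarrow> nat set \<Rightarrow> bool" where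
  "vset d A \<longleftrightarrow> A \<subseteq> verts G \<and> encodes_set d A"

lemma N_bounds:
  "length vl \<le> N" "length el \<le> N" "v \<in> verts G \<Longrightarrow> size (enc_nat v) \<le> N"
proof -
  show "length vl \<le> N" "length el \<le> N"
    using N length_le_size_enc_list[of vl enc_nat] length_le_size_enc_list[of el enc_edge]
        by linarith+
  show "size (enc_nat v) \<le> N" if "v \<in> verts G"
    using N size_le_size_enc_list[of v vl enc_nat] that[folded vl(2)] by linarith
qed

lemma edges_iff: "{u, v} \<in> edges G \<longleftrightarrow> (u, v) \<in> set el \<or> (v, u) \<in> set el"
proof
  assume "{u, v} \<in> edges G"
  then obtain p where "p \<in> set el" "{u, v} = (case p of (a, b) \<Rightarrow> {a, b})"
    using el(2) by (metis (mono_tags, lifting) imageE list.set_map)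
  moreover obtain a b where "p = (a, b)" by (cases p)
  ultimately show "(u, v) \<in> set el \<or> (v, u) \<in> set el" by (auto simp: doubleton_eq_iff)
next
  have "{a, b} \<in> edges G" if "(a, b) \<in> set el" for a b
    using imageI[OF that, of "\<lambda>(u, v). {u, v}"] el(2) by simp
  then show "(u, v) \<in> set el \<or> (v, u) \<in> set el \<Longrightarrow> {u, v} \<in> edges G"
    by (metis insert_commute)
qed

lemma el_verts: "(u, v) \<in> set el \<Longrightarrow> u \<in> verts G \<and> v \<in> verts G"
  using simple_graph_edgeD[OF G] edges_iff by blast

lemma vsetE:
  assumes "vset d A"
  obtains xs where "distinct xs" "set xs = A" "d = enc_list enc_nat xs" "length xs \<le> N"
    "length xs = card A" "A \<subseteq> verts G" "size d \<le> size (enc_list enc_nat vl)"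
proof -
  obtain xs where xs: "distinct xs" "set xs = A" "d = enc_list enc_nat xs" "A \<subseteq> verts G"
    using assms by (auto simp: vset_def encodes_set_def)
  have c: "length xs = card A" using xs distinct_card by metis
  also have "\<dots> \<le> card (verts G)" using xs G by (intro card_mono) (auto simp: simple_graph_def)
  also have "\<dots> = length vl" using vl distinct_card by metis
  also have "\<dots> \<le> N" by (rule N_bounds)
  finally show ?thesis
    using that[OF xs(1-3) _ c xs(4)] size_enc_list_mono[OF xs(1)] xs vl by simp
qed

lemma dlen_vset: "vset d A \<Longrightarrow> dlen d = card A"
  by (metis vsetE dlen_enc_list)

lemma card_vset_le: "vset d A \<Longrightarrow> card A \<le> N"
  by (metis vsetE)

lemma vset_Leaf: "vset Leaf {}"
  by (simp add: vset_def encodes_set_def)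

lemma vset_filter: "vset (enc_list enc_nat (filter p vl)) {v \<in> verts G. p v}"
  unfolding vset_def encodes_set_def
  by (intro conjI exI[of _ "filter p vl"]) (use vl in auto)

lemma call_eq_verts:
  assumes "v \<in> verts G"
  shows "call eq_ix (Node (enc_nat v) (enc_nat w)) (\<lambda>r n. (r \<noteq> Leaf \<longleftrightarrow> v = w) \<and> n \<le> t_eq N)"
proof (rule call_mono[OF call_eq])
  show "(r \<noteq> Leaf \<longleftrightarrow> enc_nat v = enc_nat w) \<and> n \<le> 40 * size (enc_nat v) + 20 \<Longrightarrow>
      (r \<noteq> Leaf \<longleftrightarrow> v = w) \<and> n \<le> t_eq N" for r n
    using N_bounds(3)[OF assms] enc_nat_inject[of v w] unfolding t_eq_def by linarith
qed

lemma call_mono_bound: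
  assumes "call f u (\<lambda>r n. \<Phi> r \<and> n \<le> (m + 1) * t)" and "m \<le> N"
    and "\<And>r. \<Phi> r \<Longrightarrow> \<Psi> r" and "(N + 1) * t \<le> T"
  shows "call f u (\<lambda>r n. \<Psi> r \<and> n \<le> T)"
proof (rule call_mono[OF assms(1)])
  fix r n assume "\<Phi> r \<and> n \<le> (m + 1) * t"
  moreover have "(m + 1) * t \<le> (N + 1) * t" using assms(2) by (intro mult_le_mono) auto
  ultimately show "\<Psi> r \<and> n \<le> T" using assms(3)[of r] assms(4) by linarith
qed

lemma call_mem:
  assumes v: "v \<in> verts G" and A: "vset d A"
  shows "call mem_ix (Node (enc_nat v) d) (\<lambda>r n. (r \<noteq> Leaf \<longleftrightarrow> v \<in> A) \<and> n \<le> t_mem N)"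
proof -
  obtain xs where xs: "set xs = A" "d = enc_list enc_nat xs" "length xs \<le> N"
    using A by (rule vsetE)
  have "call mem_ix (Node (enc_nat v) d)
      (\<lambda>r n. r = enc_list enc_nat (filter (\<lambda>w. v = w) xs) \<and> n \<le> (length xs + 1) * (t_eq N + 20))"
    unfolding xs(2) by (rule call_filter[OF call_filter_ixs(1) call_eq_verts[OF v]])
  then show ?thesis
    by (rule call_mono_bound[OF _ xs(3)])
      (use xs(1) in \<open>auto simp: t_mem_def enc_list_eq_Leaf_iff filter_empty_conv\<close>)
qed

lemma call_union:
  assumes A: "vset a A" and B: "vset b B"
  shows "call union_ix (Node (Node a b) (enc_list enc_nat vl))
      (\<lambda>r n. vset r (A \<union> B) \<and> n \<le> t_union N)"
proof -
  have test: "call or_ix (Node (Node a b) (enc_nat v))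
      (\<lambda>r n. (r \<noteq> Leaf \<longleftrightarrow> v \<in> A \<or> v \<in> B) \<and> n \<le> 2 * t_mem N + 30)"
    if "v \<in> set vl" for v
    by (rule call_or_ix, simp add: or_body_def, rule call_mono[OF call_mem[OF _ A]])
      (use that vl(2) in \<open>auto split: data.split intro!: call_mono[OF call_mem[OF _ B]]\<close>)
  have call: "call union_ix (Node (Node a b) (enc_list enc_nat vl))
      (\<lambda>r n. r = enc_list enc_nat (filter (\<lambda>v. v \<in> A \<or> v \<in> B) vl) \<and>
        n \<le> (length vl + 1) * (2 * t_mem N + 30 + 20))"
    by (rule call_filter[OF call_filter_ixs(2) test])
  have "{v \<in> verts G. v \<in> A \<or> v \<in> B} = A \<union> B" using A B by (auto simp: vset_def)
  then have "vset (enc_list enc_nat (filter (\<lambda>v. v \<in> A \<or> v \<in> B) vl)) (A \<union> B)"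
    using vset_filter[of "\<lambda>v. v \<in> A \<or> v \<in> B"] by simp
  then show ?thesis
    by (intro call_mono_bound[OF call N_bounds(1)]) (simp_all add: t_union_def)
qed

lemma call_diff:
  assumes A: "vset a A" and B: "vset b B"
  shows "call diff_ix (Node a b) (\<lambda>r n. vset r (B - A) \<and> n \<le> t_union N)"
proof -
  obtain xs where xs: "distinct xs" "set xs = B"
      "b = enc_list enc_nat xs" "length xs \<le> N" "B \<subseteq> verts G"
    using B by (rule vsetE)
  have test: "call not_ix (Node a (enc_nat v)) (\<lambda>r n. (r \<noteq> Leaf \<longleftrightarrow> v \<notin> A) \<and> n \<le> t_mem N + 30)"
    if "v \<in> set xs" for v
    by (rule call_not_ix, simp add: not_body_def, rule call_mono[OF call_mem[OF _ A]])
      (use that xs in \<open>auto split: data.split\<close>)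
  have call: "call diff_ix (Node a b)
      (\<lambda>r n. r = enc_list enc_nat (filter (\<lambda>v. v \<notin> A) xs)
          \<and> n \<le> (length xs + 1) * (t_mem N + 30 + 20))"
    unfolding xs(3) by (rule call_filter[OF call_filter_ixs(3) test])
  have "vset (enc_list enc_nat (filter (\<lambda>v. v \<notin> A) xs)) (B - A)"
    using xs by (auto simp: vset_def encodes_set_def intro!: exI[of _ "filter (\<lambda>v. v \<notin> A) xs"])
  then show ?thesis
    by (intro call_mono_bound[OF call xs(4)]) (simp_all add: t_union_def algebra_simps)
qed

lemma call_induce:
  assumes A: "vset a A"
  shows "call induce_ix (Node a (enc_list enc_edge el))
    (\<lambda>r n. r = enc_list enc_edge (filter (\<lambda>(u, v). u \<in> A \<and> v \<in> A) el) \<and> n \<le> t_union N)"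
proof -
  have test: "call inside_ix (Node a (enc_edge e))
      (\<lambda>r n. (r \<noteq> Leaf \<longleftrightarrow> (case e of (u, v) \<Rightarrow> u \<in> A \<and> v \<in> A)) \<and> n \<le> 2 * t_mem N + 30)"
    if "e \<in> set el" for e
  proof (cases e)
    case (Pair u v)
    then have uv: "u \<in> verts G" "v \<in> verts G" using el_verts that by auto
    show ?thesis
      by (rule call_inside_ix, simp add: inside_body_def Pair enc_edge_def,
          rule call_mono[OF call_mem[OF uv(1) A]])
        (auto split: data.split intro!: call_mono[OF call_mem[OF uv(2) A]])
  qed
  have "call induce_ix (Node a (enc_list enc_edge el))
    (\<lambda>r n. r = enc_list enc_edge (filter (\<lambda>(u, v). u \<in> A \<and> v \<in> A) el)
        \<and> n \<le> (length el + 1) * (2 * t_mem N + 30 + 20))"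
    by (rule call_filter[OF call_filter_ixs(4) test])
  then show ?thesis
    by (rule call_mono_bound[OF _ N_bounds(2)]) (simp_all add: t_union_def)
qed

text \<open>Each edge is listed once as an unordered pair, and mapping a neighbour \<open>u\<close>
  to \<open>{u, v}\<close> is injective, so incident entries and neighbours are equally
  many.\<close>

lemma length_star: "length (filter (\<lambda>(a, b). v = a \<or> v = b) el) = vertex_degree G v"
proof -
  let ?xs = "filter (\<lambda>(a, b). v = a \<or> v = b) el"
  have "distinct (map (\<lambda>(u, v). {u, v}) ?xs)" using el(1) by (rule distinct_map_filter)
  then have "length ?xs = card (set (map (\<lambda>(u, v). {u, v}) ?xs))"
    by (metis distinct_card length_map)
  also have "set (map (\<lambda>(u, v). {u, v}) ?xs) = (\<lambda>u. {u, v}) ` {u. {u, v} \<in> edges G}"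
  proof (intro equalityI subsetI)
    fix e assume "e \<in> set (map (\<lambda>(u, v). {u, v}) ?xs)"
    then obtain a b where ab: "(a, b) \<in> set el" "v = a \<or> v = b" "e = {a, b}" by auto
    then obtain u where "e = {u, v}" by blast
    moreover have "e \<in> edges G" using ab edges_iff by simp
    ultimately show "e \<in> (\<lambda>u. {u, v}) ` {u. {u, v} \<in> edges G}" by blast
  next
    fix e assume "e \<in> (\<lambda>u. {u, v}) ` {u. {u, v} \<in> edges G}"
    then obtain u where u: "e = {u, v}" "(u, v) \<in> set el \<or> (v, u) \<in> set el"
      using edges_iff by blast
    then obtain p where "p \<in> set ?xs" "e = (case p of (u, v) \<Rightarrow> {u, v})" by force
    then show "e \<in> set (map (\<lambda>(u, v). {u, v}) ?xs)" by simp
  qed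
  also have "card \<dots> = card {u. {u, v} \<in> edges G}"
    by (rule card_image) (auto simp: inj_on_def doubleton_eq_iff)
  finally show ?thesis by (simp add: vertex_degree_def)
qed

lemma call_star:
  assumes v: "v \<in> verts G"
  shows "call star_ix (Node (enc_nat v) (enc_list enc_edge el))
      (\<lambda>r n. dlen r = vertex_degree G v \<and> n \<le> t_star N)"
proof -
  have test: "call incident_ix (Node (enc_nat v) (enc_edge e))
      (\<lambda>r n. (r \<noteq> Leaf \<longleftrightarrow> (case e of (a, b) \<Rightarrow> v = a \<or> v = b)) \<and> n \<le> 2 * t_eq N + 30)"
    for e
  proof (cases e)
    case (Pair a b)
    show ?thesis
      by (rule call_incident_ix, simp add: incident_body_def Pair enc_edge_def,
          rule call_mono[OF call_eq_verts[OF v]])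
        (auto split: data.split intro!: call_mono[OF call_eq_verts[OF v]])
  qed
  have "call star_ix (Node (enc_nat v) (enc_list enc_edge el))
    (\<lambda>r n. r = enc_list enc_edge (filter (\<lambda>(a, b). v = a \<or> v = b) el)
        \<and> n \<le> (length el + 1) * (2 * t_eq N + 30 + 20))"
    by (rule call_filter[OF call_filter_ixs(5) test])
  then show ?thesis
    by (rule call_mono_bound[OF _ N_bounds(2)])
        (use length_star[of v] in \<open>simp_all add: t_star_def\<close>)
qed

lemma vertex_degree_le_N: "vertex_degree G v \<le> N"
  unfolding length_star[symmetric] using length_filter_le N_bounds(2) by (rule order_trans)

lemma max_degree_eq_fold: "max_degree G = fold max (map (vertex_degree G) vl) 0"
  unfolding max_degree_def Max.set_eq_fold[symmetric] using vl(2) by simp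

lemma call_max_degree:
  "call max_degree_ix (Node (enc_list enc_edge el) (Node Leaf (enc_list enc_nat vl)))
     (\<lambda>r n. dlen r = max_degree G \<and> n \<le> t_degree N)"
proof -
  \<comment> \<open>The remaining fold is started from the accumulator. Initially this is
    \<open>Leaf\<close>, of length 0, matching the 0 inserted in \<open>max_degree\<close>.\<close>
  let ?Inv = "\<lambda>xs a. set xs \<subseteq> verts G \<and> fold max (map (vertex_degree G) xs) (dlen a) = max_degree G"
  have "call max_degree_ix (Node (enc_list enc_edge el) (Node Leaf (enc_list enc_nat vl)))
     (\<lambda>r n. ?Inv [] r \<and> n \<le> (length vl + 1) * (t_star N + 20 * N + 60 + 20))"
  proof (rule call_fold[where j = degree_ix and Inv = ?Inv, OF call_fold_ixs(1)])
    fix x xs a assume *: "?Inv (x # xs) a"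
    then have x: "x \<in> verts G" by simp
    show "call degree_ix (Node (enc_list enc_edge el) (Node a (enc_nat x)))
      (\<lambda>r n. ?Inv xs r \<and> n \<le> t_star N + 20 * N + 60)"
      apply (rule call_degree_ix, simp add: degree_body_def)
      apply (rule call_mono[OF call_star[OF x]])
      apply (rule call_mono[OF call_leq])
      subgoal for d n r m
        using * vertex_degree_le_N[of x] by (cases r) (auto simp: max_def split: if_splits)
      done
  next
    show "?Inv vl Leaf" using vl(2) max_degree_eq_fold by simp
  qed
  then show ?thesis
    by (rule call_mono_bound[OF _ N_bounds(1)]) (simp_all add: t_degree_def)
qed

section \<open>Running the cutting phase\<close>

definition rep_state :: "data \<Rightarrow> nat set \<times> nat set \<times> nat set list \<Rightarrow> bool" where
  "rep_state d = (\<lambda>(S, R, Ps). \<exists>s r ps. d = Node s (Node r (enc_list (\<lambda>d. d) ps)) \<and>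
     vset s S \<and> vset r R \<and> list_all2 vset ps Ps)"

definition rep_result :: "data \<Rightarrow> nat set \<times> nat set \<times> nat set \<times> nat set list \<Rightarrow> bool" where
  "rep_result d = (\<lambda>(W, st). \<exists>w s. d = Node w s \<and> vset w W \<and> rep_state s st)"

text \<open>\<open>K\<close> determines the result and involves the maximum degree; the time is
  stated with an upper bound \<open>K'\<close>, which can later be chosen in terms of the input
  size.\<close>

lemma call_cut:
  assumes b: "vset b B" and w: "vset w W" and d: "rep_result d (W', S, R, Ps)"
    and K: "dlen kd = K" "K \<le> K'"
  shows "call cut_ix (Node (Node (enc_list enc_nat vl) kd) (Node b (Node w d)))
    (\<lambda>r n. rep_result r (cut K B W (W', S, R, Ps)) \<and> n \<le> t_cut N K')"
proof -
  obtain w' s r ps where d': "d = Node w' (Node s (Node r (enc_list (\<lambda>d. d) ps)))"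
    and w': "vset w' W'" and s: "vset s S" and r: "vset r R" and ps: "list_all2 vset ps Ps"
    using d by (auto simp: rep_result_def rep_state_def)
  have mult: "call mult_ix (Node b (Node Leaf kd)) (\<lambda>v n. dlen v = K * card B \<and> n \<le> t_mult N K')"
  proof (rule call_mono[OF call_mult])
    fix v n assume *: "dlen v = dlen kd * dlen b \<and> n \<le> (dlen kd + 1) * ((dlen b + 1) * 30 + 40)"
    have "(dlen kd + 1) * ((dlen b + 1) * 30 + 40) \<le> t_mult N K'"
      unfolding t_mult_def using K card_vset_le[OF b] dlen_vset[OF b] by (intro mult_le_mono) auto
    then show "dlen v = K * card B \<and> n \<le> t_mult N K'" using * K dlen_vset[OF b] by auto
  qed
  have KB: "K * card B \<le> K' * N" using K card_vset_le[OF b] by (intro mult_le_mono) auto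
  show ?thesis
    unfolding d'
    apply (rule call_cut_ix, simp add: cut_body_def)
    apply (rule call_mono[OF call_union[OF w w']])
    apply (elim conjE)
    apply (rule call_mono[OF call_diff[OF r]], assumption)
    apply (elim conjE)
    apply (rule call_mono[OF mult])
    apply (elim conjE)
    apply (rule call_mono[OF call_leq])
    apply (elim conjE)
    subgoal for u n1 q n2 m n3 v n4
    proof (cases v)
      case Leaf
      assume *: "vset u (W \<union> W')" "n1 \<le> t_union N" "vset q (W \<union> W' - R)" "n2 \<le> t_union N"
        "dlen m = K * card B" "n3 \<le> t_mult N K'"
            "(v \<noteq> Leaf) = (dlen m \<le> dlen q)" "n4 \<le> 20 * dlen m + 20"
      then show ?thesis
        using Leaf KB s r ps dlen_vset[OF *(3)]
        by (auto simp: rep_result_def rep_state_def cut_def Let_def t_cut_def)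
    next
      case (Node v1 v2)
      assume *: "vset u (W \<union> W')" "n1 \<le> t_union N" "vset q (W \<union> W' - R)" "n2 \<le> t_union N"
        "dlen m = K * card B" "n3 \<le> t_mult N K'"
            "(v \<noteq> Leaf) = (dlen m \<le> dlen q)" "n4 \<le> 20 * dlen m + 20"
      then have cut: "cut K B W (W', S, R, Ps) = ({}, S \<union> B, R \<union> (W \<union> W' - R), (W \<union> W' - R) # Ps)"
        using Node dlen_vset[OF *(3)] by (simp add: cut_def Let_def)
      define Q where "Q = W \<union> W' - R"
      have q: "vset q Q" using *(3) by (simp add: Q_def)
      have rep: "rep_result (Node Leaf (Node s' (Node r' (Node q (enc_list (\<lambda>d. d) ps)))))
          ({}, S \<union> B, R \<union> Q, Q # Ps)"
        if "vset s' (S \<union> B)" "vset r' (R \<union> Q)" for s' r'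
        unfolding rep_result_def rep_state_def prod.case
        by (intro exI conjI, rule refl, rule vset_Leaf,
            subst enc_list.simps(2)[symmetric], rule refl)
          (use that q ps in simp_all)
      show ?thesis
        unfolding cut Node Q_def[symmetric]
        apply simp
        apply (rule call_mono[OF call_union[OF s b]])
        apply (elim conjE)
        apply (rule call_mono[OF call_union[OF r q]])
        apply (elim conjE)
        apply (rule conjI, rule rep, assumption, assumption)
        using * KB unfolding t_cut_def by linarith
    qed
    done
qed

text \<open>Each child costs one cut and two recursive calls. Its encoding has two constructors more
  than the two lists of these calls together, so the factor \<open>2 * size + 1\<close> leaves room
  for the cut.\<close>

lemma call_forest:
  assumes K: "dlen kd = K" "K \<le> K'"
  shows "list_all2 encodes_rtree ds ts \<Longrightarrow> vset b B \<Longrightarrow> rep_result d (W, S, R, Ps) \<Longrightarrow>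
    \<Union>(\<Union>(set_rtree ` set ts)) \<subseteq> verts G \<Longrightarrow>
    call forest_ix (Node (Node (enc_list enc_nat vl) kd) (Node b (Node (enc_list (\<lambda>d. d) ds) d)))
      (\<lambda>r n. rep_result r (cut_forest K B ts (W, S, R, Ps)) \<and>
        n \<le> (2 * size (enc_list (\<lambda>d. d) ds) + 1) * (t_cut N K' + 70))"
proof (induction ts arbitrary: ds b B d W S R Ps rule: measure_induct_rule[of "size_list size"])
  case (less fs)
  obtain w s where d: "d = Node w s" and w: "vset w W" and s: "rep_state s (S, R, Ps)"
    using less.prems(3) by (auto simp: rep_result_def)
  show ?case
  proof (cases fs)
    case Nil
    then show ?thesis
      using less.prems by (intro call_forest_ix) (simp add: forest_body_def)
  next
    case (Cons t ts)
    obtain B' ts' where t: "t = Rooted B' ts'" by (cases t)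
    obtain e ds2 where ds: "ds = e # ds2" "encodes_rtree e t" "list_all2 encodes_rtree ds2 ts"
      using less.prems(1) by (auto simp: Cons list_all2_Cons2)
    obtain b' ds1 where e: "e = Node b' (enc_list (\<lambda>d. d) ds1)" "encodes_set b' B'"
        "list_all2 encodes_rtree ds1 ts'"
      using ds(2) by (auto simp: t elim: encodes_rtree.cases)
    have b': "vset b' B'" using e less.prems(4) by (auto simp: vset_def Cons t)
    obtain W2 S2 R2 Ps2 where r2: "cut_forest K B' ts' (B', S, R, Ps) = (W2, S2, R2, Ps2)"
      by (metis prod_cases4)
    obtain W3 S3 R3 Ps3 where r3: "cut K B W (W2, S2, R2, Ps2) = (W3, S3, R3, Ps3)"
      by (metis prod_cases4)
    have res: "rep_result (Node b' s) (B', S, R, Ps)" using b' s by (auto simp: rep_result_def)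
    have IH1: "call forest_ix (Node (Node (enc_list enc_nat vl) kd)
        (Node b' (Node (enc_list (\<lambda>d. d) ds1) (Node b' s))))
      (\<lambda>r n. rep_result r (W2, S2, R2, Ps2) \<and>
        n \<le> (2 * size (enc_list (\<lambda>d. d) ds1) + 1) * (t_cut N K' + 70))"
      unfolding r2[symmetric]
      by (rule less.IH[OF _ e(3) b' res]) (use less.prems(4) in \<open>auto simp: Cons t\<close>)
    have IH2: "call forest_ix (Node (Node (enc_list enc_nat vl) kd)
        (Node b (Node (enc_list (\<lambda>d. d) ds2) r)))
      (\<lambda>r n. rep_result r (cut_forest K B ts (W3, S3, R3, Ps3)) \<and>
        n \<le> (2 * size (enc_list (\<lambda>d. d) ds2) + 1) * (t_cut N K' + 70))"
      if "rep_result r (W3, S3, R3, Ps3)" for r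
      by (rule less.IH[OF _ ds(3) less.prems(2) that]) (use less.prems(4) in \<open>auto simp: Cons t\<close>)
    have cut_eq: "cut_forest K B fs (W, S, R, Ps) = cut_forest K B ts (W3, S3, R3, Ps3)"
      by (simp add: Cons t r2 r3)
    show ?thesis
      unfolding cut_eq
      apply (rule call_forest_ix, simp add: forest_body_def ds(1) e(1) d)
      apply (rule call_mono[OF IH1])
      apply (elim conjE)
      apply (rule call_mono[OF call_cut[OF less.prems(2) w _ K]], assumption)
      apply (elim conjE)
      apply (rule call_mono[OF IH2])
       apply (simp add: r3)
      apply (simp add: algebra_simps)
      done
  qed
qed

end

lemma enc_list_map: "enc_list f (map g xs) = enc_list (\<lambda>x. f (g x)) xs"
  by (induction xs) auto

lemma size_enc_list_filter: "size (enc_list f (filter p xs)) \<le> size (enc_list f xs)"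
  by (induction xs) auto

lemma cut_length: "cut K B W (W', S, R, Ps) = (W1, S1, R1, Ps1) \<Longrightarrow> length Ps1 \<le> Suc (length Ps)"
  by (auto simp: cut_def Let_def split: if_splits)

text \<open>Each tree node in the forest causes at most one cut. This bounds the number of queries
  by the input size.\<close>

lemma cut_forest_length:
  "list_all2 encodes_rtree ds ts \<Longrightarrow> cut_forest K B ts (W, S, R, Ps) = (W1, S1, R1, Ps1) \<Longrightarrow>
    length Ps1 \<le> length Ps + size (enc_list (\<lambda>d. d) ds)"
proof (induction ts arbitrary: ds B W S R Ps W1 S1 R1 Ps1
    rule: measure_induct_rule[of "size_list size"])
  case (less fs)
  show ?case
  proof (cases fs)
    case Nil
    then show ?thesis using less.prems by simp
  next
    case (Cons t ts)
    obtain B' ts' where t: "t = Rooted B' ts'" by (cases t)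
    obtain e ds2 where ds: "ds = e # ds2" "encodes_rtree e t" "list_all2 encodes_rtree ds2 ts"
      using less.prems(1) by (auto simp: Cons list_all2_Cons2)
    obtain b' ds1 where e: "e = Node b' (enc_list (\<lambda>d. d) ds1)" "list_all2 encodes_rtree ds1 ts'"
      using ds(2) by (auto simp: t elim: encodes_rtree.cases)
    obtain W2 S2 R2 Ps2 where r2: "cut_forest K B' ts' (B', S, R, Ps) = (W2, S2, R2, Ps2)"
      by (metis prod_cases4)
    obtain W3 S3 R3 Ps3 where r3: "cut K B W (W2, S2, R2, Ps2) = (W3, S3, R3, Ps3)"
      by (metis prod_cases4)
    have r1: "cut_forest K B ts (W3, S3, R3, Ps3) = (W1, S1, R1, Ps1)"
      using less.prems(2) by (simp add: Cons t r2 r3)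
    have "length Ps2 \<le> length Ps + size (enc_list (\<lambda>d. d) ds1)"
      by (rule less.IH[OF _ e(2) r2]) (simp add: Cons t)
    moreover have "length Ps1 \<le> length Ps3 + size (enc_list (\<lambda>d. d) ds2)"
      by (rule less.IH[OF _ ds(3) r1]) (simp add: Cons)
    ultimately show ?thesis using cut_length[OF r3] by (simp add: ds(1) e(1))
  qed
qed

section \<open>Queries and the assembly of their answers\<close>

context program_on_graph
begin

lemma encodes_induced:
  assumes "vset q A"
  shows "encodes_graph (Node q (enc_list enc_edge (filter (\<lambda>(u, v). u \<in> A \<and> v \<in> A) el)))
      (induced G A)"
proof -
  let ?xs = "filter (\<lambda>(u, v). u \<in> A \<and> v \<in> A) el"
  have d: "distinct (map (\<lambda>(u, v). {u, v}) ?xs)" using el(1) by (rule distinct_map_filter)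
  have "set (map (\<lambda>(u, v). {u, v}) ?xs) = {e \<in> edges G. e \<subseteq> A}"
    unfolding el(2)[symmetric] by auto
  then have "encodes_edges (enc_list enc_edge ?xs) (edges (induced G A))"
    unfolding encodes_edges_def enc_edge_def using d by (intro exI[of _ ?xs]) simp
  then show ?thesis using assms by (simp add: encodes_graph_def vset_def)
qed

text \<open>\<open>answer\<close> combines the two facts about induced subgraphs of at most
  \<open>M\<close> vertices: their encodings are admissible queries, and the oracle approximates
  them. \<open>A\<close> holds the earlier solutions, which avoid the new part
  \<open>P\<close>.\<close>

lemma call_query:
  assumes answer: "\<And>A d. A \<subseteq> verts G \<Longrightarrow> card A \<le> M \<Longrightarrow> encodes_graph d (induced G A) \<Longrightarrow>
      ok d \<and> (\<exists>X. encodes_set (orc d) X \<and> approx_ids c (induced G A) X)"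
    and s: "vset s S" and p: "vset p P" and a: "vset a A" and AP: "A \<inter> P = {}"
    and M: "card (P - S) \<le> M"
  shows "call query_ix (Node (Node s (enc_list enc_edge el)) (Node a p))
    (\<lambda>r n. (\<exists>X. approx_ids c (induced G (P - S)) X \<and> vset r (A \<union> X)) \<and> n \<le> t_query N)"
proof -
  let ?es = "enc_list enc_edge (filter (\<lambda>(u, v). u \<in> P - S \<and> v \<in> P - S) el)"
  have post: "ok (Node q ?es) \<and> call append_ix (Node Leaf (Node a (orc (Node q ?es))))
      (\<lambda>r n. (\<exists>X. approx_ids c (induced G (P - S)) X \<and> vset r (A \<union> X)) \<and> n \<le> 30 * N + 30)"
    if q: "vset q (P - S)" for q
  proof -
    obtain X where X: "ok (Node q ?es)" "encodes_set (orc (Node q ?es)) X"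
        "approx_ids c (induced G (P - S)) X"
      using answer[OF _ M encodes_induced[OF q]] q by (auto simp: vset_def)
    have XP: "X \<subseteq> P - S" using X(3) by (auto simp: approx_ids_def ind_dom_set_def)
    then have "vset (orc (Node q ?es)) X" using X(2) q by (auto simp: vset_def)
    then obtain xs where xs: "distinct xs"
        "set xs = X" "orc (Node q ?es) = enc_list enc_nat xs" "length xs \<le> N"
      by (rule vsetE)
    obtain ys where ys: "distinct ys" "set ys = A" "a = enc_list enc_nat ys"
      using a by (rule vsetE)
    have res: "vset (enc_list enc_nat (rev xs @ ys)) (A \<union> X)"
      unfolding vset_def encodes_set_def
    proof (intro conjI exI[of _ "rev xs @ ys"])
      show "A \<union> X \<subseteq> verts G" using a q XP by (auto simp: vset_def)
      show "distinct (rev xs @ ys)" using xs ys XP AP by auto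
    qed (use xs ys in auto)
    show ?thesis
      using X(1)
    proof (intro conjI)
      show "call append_ix (Node Leaf (Node a (orc (Node q ?es))))
        (\<lambda>r n. (\<exists>X. approx_ids c (induced G (P - S)) X \<and> vset r (A \<union> X)) \<and> n \<le> 30 * N + 30)"
        unfolding xs(3) ys(3)
        by (rule call_mono_bound[OF call_append xs(4)]) (use X(3) res in auto)
    qed
  qed
  have size_q: "size q + size ?es < N" if "vset q (P - S)" for q
  proof -
    have "size q \<le> size (enc_list enc_nat vl)" using that by (rule vsetE)
    then show ?thesis
      using N size_enc_list_filter[of enc_edge "\<lambda>(u, v). u \<in> P - S \<and> v \<in> P - S" el] by linarith
  qed
  show ?thesis
    apply (rule call_query_ix, simp add: query_body_def)
    apply (rule call_mono[OF call_diff[OF s p]])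
    apply (elim conjE)
    apply (rule call_mono[OF call_induce], assumption)
    apply (elim conjE)
    subgoal for q n r m
      using post[of q] size_q[of q]
      by (auto simp: t_query_def simp del: filter.simps elim!: call_mono)
    done
qed

lemma call_solve:
  assumes answer: "\<And>A d. A \<subseteq> verts G \<Longrightarrow> card A \<le> M \<Longrightarrow> encodes_graph d (induced G A) \<Longrightarrow>
      ok d \<and> (\<exists>X. encodes_set (orc d) X \<and> approx_ids c (induced G A) X)"
    and s: "vset s S" and ps: "list_all2 vset ps Ps"
    and disj: "sorted_wrt (\<lambda>P Q. P \<inter> Q = {}) Ps" and M: "\<forall>P\<in>set Ps. card (P - S) \<le> M"
  shows "call solve_ix (Node (Node s (enc_list enc_edge el)) (Node Leaf (enc_list (\<lambda>d. d) ps)))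
    (\<lambda>r n. (\<exists>Xs. list_all2 (\<lambda>P X. approx_ids c (induced G (P - S)) X) Ps Xs \<and> vset r (\<Union>(set Xs))) \<and>
      n \<le> (length Ps + 1) * (t_query N + 20))"
proof -
  \<comment> \<open>Encodings are paired with the sets that they encode: the program folds over the
    first components, the invariant speaks of the second ones.\<close>
  define zs where "zs = zip ps Ps"
  let ?sol = "\<lambda>P X. approx_ids c (induced G (P - S)) X"
  define Inv where "Inv = (\<lambda>rest a. \<exists>solved Xs. zs = solved @ rest \<and>
    list_all2 ?sol (map snd solved) Xs \<and> vset a (\<Union>(set Xs)))"
  have len: "length ps = length Ps" using ps by (rule list_all2_lengthD)
  have zs: "map fst zs = ps" "map snd zs = Ps" using len by (simp_all add: zs_def)
  have rep: "vset d P" if "(d, P) \<in> set zs" for d P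
    using ps that by (auto simp: zs_def list_all2_iff)
  have "call solve_ix (Node (Node s (enc_list enc_edge el)) (Node Leaf (enc_list fst zs)))
    (\<lambda>r n. Inv [] r \<and> n \<le> (length zs + 1) * (t_query N + 20))"
  proof (rule call_fold[where j = query_ix and Inv = Inv, OF call_fold_ixs(4)])
    fix x rest a assume "Inv (x # rest) a"
    then obtain solved Xs where i: "zs = solved @ x # rest"
        "list_all2 ?sol (map snd solved) Xs" "vset a (\<Union>(set Xs))"
      by (auto simp: Inv_def)
    obtain d P where x: "x = (d, P)" by (cases x)
    have P: "vset d P" "P \<in> set Ps" using rep i(1) x zs(2) by force+
    have Ps: "Ps = map snd solved @ P # map snd rest" using zs(2) i(1) x by simp
    have "X \<inter> P = {}" if X: "X \<in> set Xs" for X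
    proof -
      obtain j where "j < length Xs" "Xs ! j = X" using X by (auto simp: in_set_conv_nth)
      then have "?sol (map snd solved ! j) X" "map snd solved ! j \<in> set (map snd solved)"
        using i(2) by (metis list_all2_conv_all_nth nth_mem)+
      then show ?thesis using disj Ps
        by (fastforce simp: sorted_wrt_append approx_ids_def ind_dom_set_def)
    qed
    then have "\<Union>(set Xs) \<inter> P = {}" by blast
    then have q: "call query_ix (Node (Node s (enc_list enc_edge el)) (Node a d))
        (\<lambda>r n. (\<exists>X. ?sol P X \<and> vset r (\<Union>(set Xs) \<union> X)) \<and> n \<le> t_query N)"
      using M P by (intro call_query[OF answer s P(1) i(3)]) auto
    show "call query_ix (Node (Node s (enc_list enc_edge el)) (Node a (fst x)))
        (\<lambda>r n. Inv rest r \<and> n \<le> t_query N)"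
      unfolding x fst_conv
    proof (rule call_mono[OF q])
      fix r n assume *: "(\<exists>X. ?sol P X \<and> vset r (\<Union>(set Xs) \<union> X)) \<and> n \<le> t_query N"
      then obtain X where X: "?sol P X" "vset r (\<Union>(set Xs) \<union> X)" by blast
      have "Inv rest r"
        unfolding Inv_def
        by (intro exI[of _ "solved @ [x]"] exI[of _ "Xs @ [X]"])
          (use i X x in \<open>auto intro!: list_all2_appendI simp: Un_commute\<close>)
      then show "Inv rest r \<and> n \<le> t_query N" using * by simp
    qed
  next
    show "Inv zs Leaf" using vset_Leaf by (auto simp: Inv_def)
  qed
  then show ?thesis
  proof (subst zs(1)[symmetric], subst enc_list_map, elim call_mono)
    fix r n assume "Inv [] r \<and> n \<le> (length zs + 1) * (t_query N + 20)"
    then show "(\<exists>Xs. list_all2 ?sol Ps Xs \<and> vset r (\<Union>(set Xs)))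
        \<and> n \<le> (length Ps + 1) * (t_query N + 20)"
      using zs(2) len by (auto simp: Inv_def zs_def)
  qed
qed

lemma call_touches:
  assumes v: "v \<in> verts G" and x: "vset x X"
  shows "call touches_ix (Node (Node (enc_nat v) x) (enc_list enc_edge el))
    (\<lambda>r n. (r \<noteq> Leaf \<longleftrightarrow> (\<exists>u\<in>X. {u, v} \<in> edges G)) \<and> n \<le> t_touches N)"
proof -
  let ?p = "\<lambda>(a, b). (v = a \<and> b \<in> X) \<or> (v = b \<and> a \<in> X)"
  have test: "call touch_ix (Node (Node (enc_nat v) x) (enc_edge e))
      (\<lambda>r n. (r \<noteq> Leaf \<longleftrightarrow> ?p e) \<and> n \<le> 2 * t_eq N + 2 * t_mem N + 40)" if e: "e \<in> set el" for e
  proof (cases e)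
    case (Pair a b)
    then have ab: "a \<in> verts G" "b \<in> verts G" using el_verts e by auto
    show ?thesis
      apply (rule call_touch_ix, simp add: touch_body_def Pair enc_edge_def)
      apply (rule call_mono[OF call_eq_verts[OF v]])
      apply (elim conjE)
      subgoal for r n
        apply (cases r; simp)
         apply (rule call_mono[OF call_eq_verts[OF v]])
         apply (elim conjE)
        subgoal for r' n'
          by (cases r'; simp; intro call_mono[OF call_mem[OF ab(1) x]]; auto)
        apply (rule call_mono[OF call_mem[OF ab(2) x]])
        apply (elim conjE)
        subgoal for _ _ m l
          apply (cases m; simp)
          apply (rule call_mono[OF call_eq_verts[OF ab(1)]])
          apply (elim conjE)
          subgoal for r' n'
            by (cases r'; simp; intro call_mono[OF call_mem[OF ab(1) x]]
                call_mono[OF call_mem[OF ab(2) x]]; auto)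
          done
        done
      done
  qed
  have call: "call touches_ix (Node (Node (enc_nat v) x) (enc_list enc_edge el))
      (\<lambda>r n. r = enc_list enc_edge (filter ?p el)
          \<and> n \<le> (length el + 1) * (2 * t_eq N + 2 * t_mem N + 40 + 20))"
    by (rule call_filter[OF call_filter_ixs(6) test])
  have "filter ?p el \<noteq> [] \<longleftrightarrow> (\<exists>u\<in>X. {u, v} \<in> edges G)"
    unfolding edges_iff filter_empty_conv by auto
  then show ?thesis
    by (intro call_mono_bound[OF call N_bounds(2)])
        (simp_all add: t_touches_def enc_list_eq_Leaf_iff)
qed

text \<open>The order of \<open>vs\<close> is that of the encoding of \<open>S\<close>, hence the
  existential quantifier. The candidates are distinct and outside \<open>X\<close>, so prepending
  one never repeats an element.\<close>

lemma call_greedy: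
  assumes x: "vset x X" and s: "vset s S" and disj: "S \<inter> X = {}"
  shows "call greedy_ix (Node (enc_list enc_edge el) (Node x s))
    (\<lambda>r n. (\<exists>vs. set vs = S \<and> vset r (greedy (edges G) vs X)) \<and> n \<le> (N + 1) * (t_touches N + 40))"
proof -
  obtain vs where vs: "distinct vs" "set vs = S"
      "s = enc_list enc_nat vs" "length vs \<le> N" "S \<subseteq> verts G"
    using s by (rule vsetE)
  let ?E = "edges G"
  define Inv where "Inv = (\<lambda>us a. \<exists>Y. vset a Y \<and> greedy ?E us Y = greedy ?E vs X \<and>
    distinct us \<and> set us \<inter> Y = {} \<and> set us \<subseteq> verts G)"
  have "call greedy_ix (Node (enc_list enc_edge el) (Node x (enc_list enc_nat vs)))
    (\<lambda>r n. Inv [] r \<and> n \<le> (length vs + 1) * (t_touches N + 20 + 20))"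
  proof (rule call_fold[where j = extend_ix and Inv = Inv, OF call_fold_ixs(5)])
    fix v us a assume "Inv (v # us) a"
    then obtain Y where Y: "vset a Y" "greedy ?E (v # us) Y = greedy ?E vs X" "distinct (v # us)"
        "set (v # us) \<inter> Y = {}" "set (v # us) \<subseteq> verts G"
      by (auto simp: Inv_def)
    then have v: "v \<in> verts G" by simp
    have new: "Inv us (Node (enc_nat v) a)" if "\<not> (\<exists>u\<in>Y. {u, v} \<in> ?E)"
    proof -
      obtain ys where "distinct ys" "set ys = Y" "a = enc_list enc_nat ys" "Y \<subseteq> verts G"
        using Y(1) by (rule vsetE)
      then have "vset (enc_list enc_nat (v # ys)) (insert v Y)" "a = enc_list enc_nat ys"
        unfolding vset_def encodes_set_def using Y(4) v by (auto intro!: exI[of _ "v # ys"])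
      then show ?thesis using Y that by (auto simp: Inv_def intro!: exI[of _ "insert v Y"])
    qed
    have old: "Inv us a" if "\<exists>u\<in>Y. {u, v} \<in> ?E"
      using Y that by (auto simp: Inv_def intro!: exI[of _ Y])
    show "call extend_ix (Node (enc_list enc_edge el) (Node a (enc_nat v)))
        (\<lambda>r n. Inv us r \<and> n \<le> t_touches N + 20)"
      apply (rule call_extend_ix, simp add: extend_body_def)
      apply (rule call_mono[OF call_touches[OF v Y(1)]])
      apply (elim conjE)
      subgoal for r n using old new by (cases r) simp_all
      done
  next
    show "Inv vs x" using vs x disj by (auto simp: Inv_def)
  qed
  then show ?thesis
    unfolding vs(3)
    by (rule call_mono_bound[OF _ vs(4)]) (use vs(2) in \<open>auto simp: Inv_def\<close>)
qed

end

section \<open>The complete program\<close>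

definition t_main :: "nat \<Rightarrow> nat \<Rightarrow> nat" where
  "t_main k N =
     t_degree N + t_mult (N + 1) k + t_mult (N + 1) (k * (N + 1)) +
     (2 * N + 1) * (t_cut N (k * (N + 1)\<^sup>2) + 70) + t_union N +
     (N + 2) * (t_query N + 20) + (N + 1) * (t_touches N + 40) + 2 * k + 200"

context program_on_graph
begin

lemma max_degree_le_N: "max_degree G \<le> N"
  unfolding max_degree_def using G vertex_degree_le_N
  by (intro Max.boundedI) (auto simp: simple_graph_def)

lemma call_main_no_edges:
  assumes "el = []"
  shows "call 0 (Node (Node (enc_list enc_nat vl) (enc_list enc_edge el)) d)
    (\<lambda>r n. r = enc_list enc_nat vl \<and> n \<le> 20)"
  by (rule call_0) (simp add: main_body_def assms)

lemma call_main:
  assumes answer: "\<And>A d. A \<subseteq> verts G \<Longrightarrow> card A \<le> M \<Longrightarrow> encodes_graph d (induced G A) \<Longrightarrow>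
      ok d \<and> (\<exists>X. encodes_set (orc d) X \<and> approx_ids c (induced G A) X)"
    and el: "el \<noteq> []" and td: "tree_decomposition G (tree_graph t) (label_at t)"
    and d: "encodes_rtree d t" "size d \<le> N"
    and L: "\<And>X. X \<in> set_rtree t \<Longrightarrow> k * (max_degree G + 1)\<^sup>2 * card X \<le> L" "2 * L \<le> M"
    and k: "k \<ge> 1" and c: "c \<ge> 1" and eps: "\<epsilon> * real k \<ge> 1" "\<epsilon> > 0"
  shows "call 0 (Node (Node (enc_list enc_nat vl) (enc_list enc_edge el)) d)
    (\<lambda>r n. (\<exists>X. encodes_set r X \<and> approx_ids (c * (1 + \<epsilon>)) G X) \<and> n \<le> t_main k N)"
proof -
  obtain B ts where t: "t = Rooted B ts" by (cases t)
  obtain b ds where d': "d = Node b (enc_list (\<lambda>d. d) ds)"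
      "encodes_set b B" "list_all2 encodes_rtree ds ts"
    using d(1) by (auto simp: t elim: encodes_rtree.cases)
  obtain e es where el': "el = e # es" using el by (cases el) auto
  have finV: "finite (verts G)" using G by (simp add: simple_graph_def)
  define K where "K = k * (max_degree G + 1)\<^sup>2"
  \<comment> \<open>Since the maximum degree is at most \<open>N\<close>, this bounds
    \<open>K\<close> in terms of the input size.\<close>
  define K' where "K' = k * (N + 1)\<^sup>2"
  have K: "K \<ge> 1" "K \<le> K'"
    using k max_degree_le_N by (auto simp: K_def K'_def intro!: mult_le_mono power_mono)
  have bags: "\<Union>(set_rtree t) = verts G"
  proof -
    have "\<Union>(set_rtree t) = (\<Union>p\<in>verts (tree_graph t). label_at t p)"
      by (auto simp: set_rtree_eq_labels tree_graph_def)
    then show ?thesis using td by (simp add: tree_decomposition_def)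
  qed
  have B: "vset b B" using d'(2) bags by (auto simp: vset_def t)
  obtain W S R Ps where res: "cut_forest K B ts (B, {}, {}, []) = (W, S, R, Ps)"
    by (metis prod_cases4)
  have sep: "separated_tree (edges G) (Rooted B ts)"
    using separated_tree_subtree[OF td, of "[]" t] by (simp add: t)
  have KL: "X \<in> set_rtree (Rooted B ts) \<Longrightarrow> K * card X \<le> L" for X
    using L(1) by (simp add: K_def t)
  have "1 * card B \<le> K * card B" using K by (intro mult_le_mono) auto
  also have "\<dots> \<le> L" by (rule KL) simp
  finally have cardB: "card (B - {}) \<le> L" by (simp only: Diff_empty mult_1)
  have inv: "cut_inv G K L (S, R, Ps) \<and> B \<union> \<Union>(\<Union>(set_rtree ` set ts)) \<subseteq> W \<union> R \<and>
     W \<subseteq> B \<union> \<Union>(\<Union>(set_rtree ` set ts)) \<and> {} \<subseteq> R \<and> card (W - R) \<le> L"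
    by (rule cut_forest_invariant[OF G K(1) _ sep _ _ _ _ _ cardB KL res])
      (use bags in \<open>auto simp: cut_inv_def separated_parts_def t\<close>)
  have V: "B \<union> \<Union>(\<Union>(set_rtree ` set ts)) = verts G" using bags by (auto simp: t)
  \<comment> \<open>Whatever was not cut off becomes a last part. Every vertex lies in some bag, so
    this part is contained in \<open>W - R\<close> and has at most \<open>L\<close>
    vertices.\<close>
  define Ps' where "Ps' = (verts G - R) # Ps"
  have SR: "S \<subseteq> R" "R \<subseteq> verts G" "\<Union>(set Ps) = R" and parts: "separated_parts G S Ps"
    and Pcard: "\<forall>P\<in>set Ps. card P \<le> 2 * L" and Scard: "K * card S \<le> card R"
    using inv by (auto simp: cut_inv_def)
  have parts': "separated_parts G S Ps'"
  proof -
    \<comment> \<open>As for a cut: a neighbour in \<open>R\<close> outside \<open>S\<close> lies in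
      an old part, whose separation would put \<open>u\<close> into \<open>R\<close> as
      well.\<close>
    have "v \<in> verts G - R \<union> S" if u: "u \<in> verts G - R - S" and uv: "{u, v} \<in> edges G" for u v
    proof (rule ccontr)
      assume v: "v \<notin> verts G - R \<union> S"
      then have "v \<in> R" using simple_graph_edgeD[OF G uv] by auto
      then obtain P where P: "P \<in> set Ps" "v \<in> P - S" using SR v by auto
      then have "u \<in> P \<union> S" using parts uv by (auto simp: separated_parts_def insert_commute)
      then show False using u P SR by auto
    qed
    then show ?thesis using parts SR by (auto simp: separated_parts_def Ps'_def)
  qed
  have cover: "\<Union>(set Ps') = verts G" using SR by (auto simp: Ps'_def)
  have M: "\<forall>P\<in>set Ps'. card (P - S) \<le> M"
  proof
    fix P assume P: "P \<in> set Ps'"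
    have "card P \<le> 2 * L"
    proof (cases "P \<in> set Ps")
      case False
      then have "P \<subseteq> W - R" "finite (W - R)"
        using P inv V finV by (auto simp: Ps'_def intro: finite_subset)
      then have "card P \<le> card (W - R)" by (rule card_mono[rotated])
      then show ?thesis using inv by simp
    qed (use Pcard in auto)
    moreover have "card (P - S) \<le> card P"
      using P cover finV by (intro card_mono) (auto intro: finite_subset)
    ultimately show "card (P - S) \<le> M" using L(2) by simp
  qed
  have "card R \<le> card (verts G)" using SR finV by (intro card_mono)
  then have Scard': "k * (max_degree G + 1)\<^sup>2 * card S \<le> card (verts G)"
    using Scard by (simp add: K_def)
  \<comment> \<open>There are at most \<open>N\<close> cuts and one last part; the final step of the
    fold makes it \<open>N + 2\<close> in \<open>t_main\<close>.\<close>
  have len: "length Ps' \<le> N + 1"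
    using cut_forest_length[OF d'(3) res] d(2) by (simp add: Ps'_def d'(1))
  have vl_vset: "vset (enc_list enc_nat vl) (verts G)"
    using vset_filter[of "\<lambda>_. True"] by simp
  have rep0: "rep_result (Node b (Node Leaf (Node Leaf Leaf))) (B, {}, {}, [])"
    using B vset_Leaf by (auto simp: rep_result_def rep_state_def intro!: exI[of _ "[]"])
  have mult1: "call mult_ix (Node (Node Leaf D) (Node Leaf ((Node Leaf ^^ k) Leaf)))
      (\<lambda>v n. dlen v = k * (max_degree G + 1) \<and> n \<le> t_mult (N + 1) k)"
    if "dlen D = max_degree G" for D
  proof (rule call_mono[OF call_mult])
    fix v n assume *: "dlen v = dlen ((Node Leaf ^^ k) Leaf) * dlen (Node Leaf D) \<and>
        n \<le> (dlen ((Node Leaf ^^ k) Leaf) + 1) * ((dlen (Node Leaf D) + 1) * 30 + 40)"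
    have k: "dlen ((Node Leaf ^^ k) Leaf) = k" by (induction k) auto
    have "(dlen ((Node Leaf ^^ k) Leaf) + 1) * ((dlen (Node Leaf D) + 1) * 30 + 40)
        \<le> t_mult (N + 1) k"
      unfolding t_mult_def that k dlen.simps
          using max_degree_le_N by (intro mult_le_mono add_le_mono) auto
    then show "dlen v = k * (max_degree G + 1) \<and> n \<le> t_mult (N + 1) k"
      using * that k by auto
  qed
  have mult2: "call mult_ix (Node (Node Leaf D) (Node Leaf E))
      (\<lambda>v n. dlen v = K \<and> n \<le> t_mult (N + 1) (k * (N + 1)))"
    if "dlen D = max_degree G" "dlen E = k * (max_degree G + 1)" for D E
  proof (rule call_mono[OF call_mult])
    fix v n assume *: "dlen v = dlen E * dlen (Node Leaf D) \<and>
        n \<le> (dlen E + 1) * ((dlen (Node Leaf D) + 1) * 30 + 40)"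
    have "(dlen E + 1) * ((dlen (Node Leaf D) + 1) * 30 + 40) \<le> t_mult (N + 1) (k * (N + 1))"
      unfolding t_mult_def that dlen.simps
          using max_degree_le_N by (intro mult_le_mono add_le_mono) auto
    then show "dlen v = K \<and> n \<le> t_mult (N + 1) (k * (N + 1))"
      using * that by (auto simp: K_def power2_eq_square algebra_simps)
  qed
  have forest: "call forest_ix (Node (Node (enc_list enc_nat vl) kd)
        (Node b (Node (enc_list (\<lambda>d. d) ds) (Node b (Node Leaf (Node Leaf Leaf))))))
      (\<lambda>r n. rep_result r (W, S, R, Ps) \<and> n \<le> (2 * N + 1) * (t_cut N K' + 70))"
    if kd: "dlen kd = K" for kd
  proof (rule call_mono[OF call_forest[OF kd K(2) d'(3) B rep0]])
    show "\<Union>(\<Union>(set_rtree ` set ts)) \<subseteq> verts G" using V by auto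
    fix r n assume *: "rep_result r (cut_forest K B ts (B, {}, {}, [])) \<and>
        n \<le> (2 * size (enc_list (\<lambda>d. d) ds) + 1) * (t_cut N K' + 70)"
    have "(2 * size (enc_list (\<lambda>d. d) ds) + 1) * (t_cut N K' + 70)
        \<le> (2 * N + 1) * (t_cut N K' + 70)"
      using d(2) by (intro mult_le_mono) (auto simp: d'(1))
    then show "rep_result r (W, S, R, Ps) \<and> n \<le> (2 * N + 1) * (t_cut N K' + 70)"
      using * unfolding res by linarith
  qed
  have solve: "call solve_ix (Node (Node s (enc_list enc_edge el))
      (Node Leaf (Node q (enc_list (\<lambda>d. d) ps))))
      (\<lambda>r n. (\<exists>Xs. list_all2 (\<lambda>P X. approx_ids c (induced G (P - S)) X) Ps' Xs \<and> vset r (\<Union>(set Xs))) \<and>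
        n \<le> (N + 2) * (t_query N + 20))"
    if "vset s S" "vset q (verts G - R)" "list_all2 vset ps Ps" for s q ps
  proof -
    have "list_all2 vset (q # ps) Ps'" using that by (simp add: Ps'_def)
    then have "call solve_ix (Node (Node s (enc_list enc_edge el))
        (Node Leaf (enc_list (\<lambda>d. d) (q # ps))))
      (\<lambda>r n. (\<exists>Xs. list_all2 (\<lambda>P X. approx_ids c (induced G (P - S)) X) Ps' Xs \<and> vset r (\<Union>(set Xs))) \<and>
        n \<le> (length Ps' + 1) * (t_query N + 20))"
      using parts' M by (intro call_solve[OF answer that(1)]) (auto simp: separated_parts_def)
    moreover have "(length Ps' + 1) * (t_query N + 20) \<le> (N + 2) * (t_query N + 20)"
      using len by (intro mult_le_mono) auto
    ultimately show ?thesis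
      unfolding enc_list.simps(2) by (elim call_mono) (meson order_trans)
  qed
  have greedy: "call greedy_ix (Node (enc_list enc_edge el) (Node x s))
      (\<lambda>r n. (\<exists>X. encodes_set r X \<and> approx_ids (c * (1 + \<epsilon>)) G X)
          \<and> n \<le> (N + 1) * (t_touches N + 40))"
    if s: "vset s S" and Xs: "list_all2 (\<lambda>P X. approx_ids c (induced G (P - S)) X) Ps' Xs"
      and x: "vset x (\<Union>(set Xs))" for x s Xs
  proof -
    have "list_all2 (\<lambda>P X. ind_dom_set (induced G (P - S)) X) Ps' Xs"
      using Xs by (rule list_all2_mono) (simp add: approx_ids_def)
    then have "S \<inter> \<Union>(set Xs) = {}" using union_of_part_solutions(2)[OF parts' cover] by blast
    then show ?thesis
    proof (rule call_mono[OF call_greedy[OF x s]], intro conjI)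
      fix r n assume *: "(\<exists>vs. set vs = S \<and> vset r (greedy (edges G) vs (\<Union>(set Xs)))) \<and>
          n \<le> (N + 1) * (t_touches N + 40)"
      then obtain vs where vs: "set vs = S" "vset r (greedy (edges G) vs (\<Union>(set Xs)))" by blast
      then show "\<exists>X. encodes_set r X \<and> approx_ids (c * (1 + \<epsilon>)) G X"
        using greedy_approx_ids[OF G vs(1) _ parts' cover Xs Scard' c eps] SR
        by (auto simp: vset_def)
      show "n \<le> (N + 1) * (t_touches N + 40)" using * by blast
    qed
  qed
  have tail: "call diff_ix (Node r (enc_list enc_nat vl)) (\<lambda>q n. vset q (verts G - R)
      \<and> n \<le> t_union N)"
    if "vset r R" for r
    by (rule call_diff[OF that vl_vset])
  \<comment> \<open>With names for the nonlinear summands, the total running time is a matter of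
    linear arithmetic.\<close>
  define T2 T3 T4 T5 T6 where T_defs: "T2 = t_mult (N + 1) k" "T3 = t_mult (N + 1) (k * (N + 1))"
    "T4 = (2 * N + 1) * (t_cut N K' + 70)" "T5 = (N + 2) * (t_query N + 20)"
    "T6 = (N + 1) * (t_touches N + 40)"
  have el_Node: "\<exists>u v. enc_list enc_edge el = Node u v" by (simp add: el')
  then obtain eu ev where el_enc: "enc_list enc_edge el = Node eu ev" by blast
  show ?thesis
    unfolding d'(1)
    apply (rule call_0, simp add: main_body_def el_enc)
    unfolding el_enc[symmetric]
    apply (rule call_mono[OF call_max_degree])
    apply (elim conjE)
    apply (rule call_mono[OF mult1], assumption)
    apply (elim conjE)
    apply (rule call_mono[OF mult2], assumption, assumption)
    apply (elim conjE)
    apply (rule call_mono[OF forest], assumption)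
    subgoal premises prems for D n1 E n2 kd n3 r n4
    proof -
      obtain w s r' ps where r: "r = Node w (Node s (Node r' (enc_list (\<lambda>d. d) ps)))"
        and reps: "vset s S" "vset r' R" "list_all2 vset ps Ps"
        using prems(7) by (auto simp: rep_result_def rep_state_def)
      show ?thesis
        unfolding r
        apply simp
        apply (rule call_mono[OF tail[OF reps(2)]])
        apply (elim conjE)
        apply (rule call_mono[OF solve[OF reps(1) _ reps(3)]], assumption)
        apply (elim conjE exE)
        apply (rule call_mono[OF greedy[OF reps(1)]], assumption, assumption)
        apply (elim conjE)
        apply (rule conjI, assumption)
        using prems unfolding t_main_def K'_def[symmetric]
        apply (fold T_defs)
        by linarith
    qed
    done
qed

end

section \<open>The kernelization\<close>

definition is_polynomial :: "(nat \<Rightarrow> nat) \<Rightarrow> bool" where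
  "is_polynomial f \<longleftrightarrow> (\<exists>p. \<forall>n. f n = poly p n)"

lemma is_polynomial_const: "is_polynomial (\<lambda>n. c)"
  unfolding is_polynomial_def by (intro exI[of _ "[:c:]"]) simp

lemma is_polynomial_id: "is_polynomial (\<lambda>n. n)"
  unfolding is_polynomial_def by (intro exI[of _ "[:0, 1:]"]) simp

lemma is_polynomial_add: "is_polynomial f \<Longrightarrow> is_polynomial g \<Longrightarrow> is_polynomial (\<lambda>n. f n + g n)"
  unfolding is_polynomial_def by (metis poly_add)

lemma is_polynomial_mult: "is_polynomial f \<Longrightarrow> is_polynomial g \<Longrightarrow> is_polynomial (\<lambda>n. f n * g n)"
  unfolding is_polynomial_def by (metis poly_mult)

lemma is_polynomial_t_main: "is_polynomial (t_main k)"
  unfolding t_main_def t_degree_def t_mult_def t_cut_def t_union_def t_query_def t_touches_def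
    t_star_def t_mem_def t_eq_def power2_eq_square
  by (intro is_polynomial_add is_polynomial_mult is_polynomial_const is_polynomial_id)

section \<open>The size of the queries\<close>

lemma card_bag_le_width:
  assumes "tree_decomposition G T X" "x \<in> verts T"
  shows "card (X x) \<le> width T X + 1"
proof -
  have "finite (verts T)"
    using assms(1) by (simp add: tree_decomposition_def is_tree_def simple_graph_def)
  then have "card (X x) \<le> Max ((\<lambda>t. card (X t)) ` verts T)" using assms(2) by (intro Max_ge) auto
  then show ?thesis by (simp add: width_def)
qed

text \<open>Some bag contains both ends of the edge. Together with \<open>max_degree_pos\<close>,
  this allows \<Delta> + 1 and tw + 1 to be replaced by 2 \<Delta> and 2 tw.\<close>

lemma width_pos:
  assumes G: "simple_graph G" and T: "tree_decomposition G T X" and e: "e \<in> edges G"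
  shows "width T X \<ge> 1"
proof -
  obtain x where x: "x \<in> verts T" "e \<subseteq> X x" using T e by (auto simp: tree_decomposition_def)
  have "X x \<subseteq> verts G" using T x(1) by (auto simp: tree_decomposition_def)
  then have "finite (X x)" using G by (auto simp: simple_graph_def intro: finite_subset)
  then have "card e \<le> card (X x)" using x(2) by (rule card_mono)
  moreover have "card e = 2" using G e by (simp add: simple_graph_def)
  ultimately show ?thesis using card_bag_le_width[OF T x(1)] by simp
qed

lemma max_degree_pos:
  assumes G: "simple_graph G" and e: "e \<in> edges G"
  shows "max_degree G \<ge> 1"
proof -
  obtain u v where uv: "e = {u, v}" using G e by (metis simple_graph_def card_2_iff)
  have "card {u} \<le> vertex_degree G v"
    unfolding vertex_degree_def using e uv by (intro card_mono finite_nbhd G) auto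
  then show ?thesis
    using vertex_degree_le[OF G, of v] simple_graph_edgeD[OF G, of u v] e uv by simp
qed

text \<open>Rounding 1 / \<epsilon> up costs at most 1, which turns it into (1 + \<epsilon>) /
  \<epsilon>. The constant 16 is the product of 2 for the two collections in a part, 4 from bounding
  \<Delta> + 1 by 2 \<Delta> under the square, and 2 from bounding tw + 1 by 2 tw.\<close>

lemma query_size_bound:
  fixes \<epsilon> :: real and tw \<Delta> k :: nat
  assumes "\<epsilon> > 0" "tw \<ge> 1" "\<Delta> \<ge> 1" "k = nat \<lceil>1 / \<epsilon>\<rceil>"
  shows "real (2 * (k * (\<Delta> + 1)\<^sup>2 * (tw + 1))) \<le> 16 * ((1 + \<epsilon>) / \<epsilon>) * real tw * real \<Delta> ^ 2"
proof -
  have "real k \<le> 1 / \<epsilon> + 1" using assms(1,4) by (simp add: of_nat_nat)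
  also have "\<dots> = (1 + \<epsilon>) / \<epsilon>" using assms(1) by (simp add: field_simps)
  finally have k: "real k \<le> (1 + \<epsilon>) / \<epsilon>" .
  have "(\<Delta> + 1)\<^sup>2 * (tw + 1) \<le> (2 * \<Delta>)\<^sup>2 * (2 * tw)"
    using assms by (intro mult_le_mono power_mono) auto
  then have "2 * (k * (\<Delta> + 1)\<^sup>2 * (tw + 1)) \<le> 2 * (k * ((2 * \<Delta>)\<^sup>2 * (2 * tw)))"
    by (simp only: mult.assoc mult_le_mono2)
  also have "\<dots> = 16 * k * tw * \<Delta> ^ 2" by (simp add: power2_eq_square)
  finally have "real (2 * (k * (\<Delta> + 1)\<^sup>2 * (tw + 1))) \<le> real (16 * k * tw * \<Delta> ^ 2)"
    by (rule of_nat_mono)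
  also have "\<dots> = 16 * real k * real tw * real \<Delta> ^ 2" by simp
  also have "\<dots> \<le> 16 * ((1 + \<epsilon>) / \<epsilon>) * real tw * real \<Delta> ^ 2"
    using k by (intro mult_right_mono mult_left_mono) auto
  finally show ?thesis .
qed

lemma approx_ids_no_edges:
  fixes c :: real
  assumes "simple_graph G" "edges G = {}" "c \<ge> 1"
  shows "approx_ids c G (verts G)"
proof -
  have "ind_dom_set G X \<longleftrightarrow> X = verts G" for X
    using assms(2) by (auto simp: ind_dom_set_def independent_def closed_nbhd_def)
  then have "ind_dom_set G (verts G)" "ids_opt G = card (verts G)"
    using ids_opt_witness[OF assms(1)] by (blast, metis)
  then show ?thesis
    using assms(3) mult_right_mono[of 1 c "real (card (verts G))"] by (simp add: approx_ids_def)
qed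

theorem theorem12:
  "\<exists>C > 0. \<forall>\<epsilon> > (0 :: real). \<exists>P.
     ids_approx_turing_kernelization (1 + \<epsilon>)
       (\<lambda>tw \<Delta>. C * ((1 + \<epsilon>) / \<epsilon>) * real tw * real \<Delta> ^ 2) P"
proof (intro exI[of _ 16] conjI allI impI)
  fix \<epsilon> :: real assume eps: "\<epsilon> > 0"
  define h where "h = (\<lambda>tw \<Delta>. 16 * ((1 + \<epsilon>) / \<epsilon>) * real tw * real \<Delta> ^ 2)"
  define k where "k = nat \<lceil>1 / \<epsilon>\<rceil>"
  have k_ge: "1 / \<epsilon> \<le> real k" unfolding k_def by (rule real_nat_ceiling_ge)
  then have "real k > 0" using eps by (smt (verit) divide_pos_pos)
  then have k: "k \<ge> 1" "\<epsilon> * real k \<ge> 1"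
    using k_ge eps by (auto simp: field_simps)
  obtain p where p: "\<And>n. t_main k n = poly p n"
    using is_polynomial_t_main by (auto simp: is_polynomial_def)
  have "ids_approx_turing_kernelization (1 + \<epsilon>) h (prog k)"
    unfolding ids_approx_turing_kernelization_def
  \<comment> \<open>The summand 30 covers the entry call and the time for graphs without edges,
    which is at most 20.\<close>
  proof (intro exI[of _ "p + [:30:]"] allI impI)
    fix G t d c orc
    assume *: "simple_graph G \<and> nice_tree_decomposition G t \<and>
        width (tree_graph t) (label_at t) = treewidth G \<and> encodes_instance d G t \<and>
        c \<ge> 1 \<and> ids_oracle c (h (treewidth G) (max_degree G)) orc"
    let ?H = "h (treewidth G) (max_degree G)"
    let ?ok = "\<lambda>q. \<exists>H. simple_graph H \<and> encodes_graph q H \<and> real (card (verts H)) \<le> ?H"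
    have G: "simple_graph G" and td: "tree_decomposition G (tree_graph t) (label_at t)"
      and w: "width (tree_graph t) (label_at t) = treewidth G" and c: "c \<ge> 1"
      using * by (auto simp: nice_tree_decomposition_def)
    obtain vl el dt where vl: "distinct vl" "set vl = verts G"
      and el: "distinct (map (\<lambda>(u, v). {u, v}) el)" "set (map (\<lambda>(u, v). {u, v}) el) = edges G"
      and d: "d = Node (Node (enc_list enc_nat vl) (enc_list enc_edge el)) dt" "encodes_rtree dt t"
      using * unfolding encodes_instance_def encodes_graph_def encodes_set_def encodes_edges_def
        enc_edge_def by blast
    \<comment> \<open>The \<open>Node\<close> constructors around the two lists in \<open>d\<close>
      make the inequality on sizes strict.\<close>
    interpret program_on_graph k orc ?ok G vl el "size d"
      by unfold_locales (use G vl el d(1) in auto)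
    have run: "call 0 d (\<lambda>r n. (\<exists>X. encodes_set r X \<and> approx_ids (c * (1 + \<epsilon>)) G X) \<and>
        n \<le> t_main k (size d) + 20)"
    proof (cases "el = []")
      case True
      have "1 * 1 \<le> c * (1 + \<epsilon>)" using c eps by (intro mult_mono) auto
      then have "approx_ids (c * (1 + \<epsilon>)) G (verts G)"
        using True el(2) by (intro approx_ids_no_edges G) auto
      then show ?thesis
        unfolding d(1) using vl
        by (intro call_mono[OF call_main_no_edges[OF True]]) (auto simp: encodes_set_def)
    next
      case False
      then obtain e where e: "e \<in> edges G" using el(2) by (cases el) auto
      let ?L = "k * (max_degree G + 1)\<^sup>2 * (treewidth G + 1)"
      \<comment> \<open>Only here is the edge \<open>e\<close> needed: it makes treewidth and
        maximum degree positive, as the multiplicative bound requires.\<close>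
      have h: "real (2 * ?L) \<le> ?H"
        unfolding h_def using width_pos[OF G td e] max_degree_pos[OF G e] w
        by (intro query_size_bound eps k_def) auto
      have answer: "?ok q \<and> (\<exists>X. encodes_set (orc q) X \<and> approx_ids c (induced G A) X)"
        if A: "A \<subseteq> verts G" "card A \<le> 2 * ?L" and q: "encodes_graph q (induced G A)" for A q
      proof -
        have "simple_graph (induced G A)" by (rule simple_graph_induced[OF G A(1)])
        moreover have "real (card (verts (induced G A))) \<le> ?H"
          using order_trans[OF of_nat_mono[OF A(2)] h] by (simp only: induced_simps)
        ultimately show ?thesis using q * unfolding ids_oracle_def by blast
      qed
      have bag: "k * (max_degree G + 1)\<^sup>2 * card X \<le> ?L" if X: "X \<in> set_rtree t" for X
      proof -
        obtain x where "x \<in> verts (tree_graph t)" "X = label_at t x"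
          using X by (auto simp: set_rtree_eq_labels tree_graph_def)
        then show ?thesis using card_bag_le_width[OF td] w by (intro mult_le_mono2) auto
      qed
      show ?thesis
        unfolding d(1)
        by (rule call_mono[OF call_main[OF answer False td d(2) _ bag order_refl k(1) c k(2) eps]])
          (use d(1) in auto)
    qed
    then have "wp (Call 0 (Var 0)) [d] (\<lambda>r n. (\<exists>X. encodes_set r X \<and> approx_ids (c * (1 + \<epsilon>)) G X) \<and>
        n \<le> poly (p + [:30:]) (size d))"
      by (auto simp: p elim!: call_mono)
    from wp_sound[OF this] show "\<exists>y n qs. runs (prog k) orc d y n qs
        \<and> n \<le> poly (p + [:30:]) (size d) \<and>
        (\<forall>q\<in>set qs. ?ok q) \<and> (\<exists>X. encodes_set y X \<and> approx_ids (c * (1 + \<epsilon>)) G X)"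
      unfolding runs_def by blast
  qed
  then show "\<exists>P. ids_approx_turing_kernelization (1 + \<epsilon>)
      (\<lambda>tw \<Delta>. 16 * ((1 + \<epsilon>) / \<epsilon>) * real tw * real \<Delta> ^ 2) P"
    unfolding h_def by blast
qed simp

end
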